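(* Every 3-stage Runge--Kutta scheme belonging to $\mathrm{EES}(2,5)$ has coefficients of the following form, for some $x\in\mathbb{R}$ with $x\neq 1,\pm\tfrac12$: $$a_{21}=\frac{1+2x}{4(1-x)},\qquad a_{31}=\frac{(4x-1)^2}{4(x-1)(1-4x^2)},\qquad a_{32}=\frac{1-x}{1-4x^2},$$ $$b_1=x,\qquad b_2=\tfrac12,\qquad b_3=\tfrac12-x,$$ with nodes $c_1=0$, $c_2=\dfrac{1+2x}{4(1-x)}$, $c_3=\dfrac{3}{4(1-x)}$, and all other $a_{ij}$ equal to $0$.
   Context: Trees and Hopf algebra. $\mathcal{T}$ is the set of (isomorphism classes of) finite unlabelled non-planar rooted trees, including the empty tree $\emptyset$; $|\tau|$ is the number of vertices, $\bullet$ the one-vertex tree, and $[\tau_1,\ldots,\tau_k]$ the tree obtained by joining the roots of $\tau_1,\ldots,\tau_k$ to a new root. The tree factorial is $\emptyset!=\bullet!=1$, $[\tau_1,\ldots,\tau_k]!=|[\tau_1,\ldots,\tau_k]|\,\tau_1!\cdots\tau_k!$. $\mathcal{H}$ is the free commutative $\mathbb{R}$-algebra on the non-empty trees (linear basis: forests; product $\mu$: juxtaposition; unit: $\emptyset$), graded by the total number $|\cdot|$ of vertices. It is the Butcher--Connes--Kreimer Hopf algebra: $\varepsilon(\emptyset)=1$, $\varepsilon(\tau)=0$ for non-empty $\tau$; $\Delta(\tau)=\tau\otimes\emptyset+\emptyset\otimes\tau+\sum_c P_c(\tau)\otimes R_c(\tau)$ for a non-empty tree $\tau$, the sum running over non-empty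 sets $c$ of edges such that each path from the root to a leaf meets at most one edge of $c$, where $R_c(\tau)$ is the component containing the root after deleting $c$ and $P_c(\tau)$ the forest of the other components; $\Delta$ is extended as an algebra morphism, and $S$ is the antipode. The maps $(\cdot)^\pm$. Let $\mathrm{Id}^{1/2}:\mathcal{H}\to\mathcal{H}$ be the unique unital algebra endomorphism with $\mu\circ(\mathrm{Id}^{1/2}\otimes\mathrm{Id}^{1/2})\circ\Delta=\mathrm{Id}$, and $\bar S(\tau)=(-1)^{|\tau|}S(\tau)$ on forests. Define linear maps on $\mathcal{H}$ by $\tau^-=\mu\circ(\bar S\otimes\mathrm{Id})\circ\Delta\circ\mathrm{Id}^{1/2}(\tau)$ and $\tau^+=\mu\circ(\mathrm{Id}\otimes((\cdot)^-\circ S))\circ\Delta(\tau)$. Runge--Kutta schemes. An $s$-stage Runge--Kutta (RK) scheme $\Psi$ is given by real coefficients $A=(a_{ij})_{1\le i,j\le s}$, $b=(b_i)_{1\le i\le s}$, with nodes $c_i=\sum_j a_{ij}$; it is explicit if $a_{ij}=0$ for $j\ge i$. All schemes are assumed consistent: $\sum_i b_i=1$. Its elementary weights function $\psi$ is the unital algebra homomorphism $\mathcal{H}\to\mathbb{R}$ given on non-empty trees by $\psi([\tau_1,\ldots,\tau_k])=\sum_i b_i\prod_{l=1}^k\psi_i(\tau_l)$, where $\psi_i([\tau_1,\ldots,\tau_k])=\sum_j a_{ij}\prod_{l=1}^k\psi_j(\tau_l)$ (for $\bullet$, $k=0$ and empty products are $1$). Orders. $\mathrm{ord}(\psi)=\sup\{n\in\mathbb{N}:\psi(\tau)=1/\tau!\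 \text{for all trees } |\tau|\le n\}$; antisymmetric order $\mathrm{ord}^+(\psi)=\sup\{n\in\mathbb{N}:\psi(\tau^+)=0\ \text{for all trees } \tau \text{ with } 1\le|\tau|\le n\}$. $\mathrm{EES}(n,m)$ is the class of explicit RK schemes with $\mathrm{ord}(\psi)=n$ and $\mathrm{ord}^+(\psi)=m$. *)

theory Defs
  imports
    "HOL-Analysis.Finite_Function_Topology"
    "HOL-Library.Multiset"
    "HOL-Library.Sublist"
    "HOL-Library.Extended_Nat"
begin

section \<open>Rooted trees and forests\<close>

text \<open>
  The type \<open>rtree\<close> contains the non-empty non-planar rooted trees: \<open>Node {#t\<^sub>1, \<dots>, t\<^sub>k#}\<close> is
  \<open>[t\<^sub>1, \<dots>, t\<^sub>k]\<close>, and the one-vertex tree is \<open>Node {#}\<close>. The empty tree is identified with the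
  empty forest \<open>{#}\<close>.
\<close>

datatype rtree = Node (subtrees: "rtree multiset")

type_synonym forest = "rtree multiset"

primrec nodes :: "rtree \<Rightarrow> nat" where
  "nodes (Node M) = Suc (\<Sum>\<^sub># (image_mset nodes M))"

primrec tree_fact :: "rtree \<Rightarrow> nat" where
  "tree_fact (Node M) = nodes (Node M) * \<Prod>\<^sub># (image_mset tree_fact M)"

definition forest_nodes :: "forest \<Rightarrow> nat" where
  "forest_nodes F = (\<Sum>t\<in>#F. nodes t)"


section \<open>Sets of edges\<close>

text \<open>
  Isomorphic branches of a tree have distinct edges, so an actual vertex set is needed to sum over
  sets of edges. It is taken from a planar drawing of the tree, in which a vertex is the list of
  child indices leading to it from the root \<open>[]\<close>. An edge is identified with its lower end, so the
  edges are the vertices other than the root.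
\<close>

datatype ptree = PNode (branches: "ptree list")

primrec shape :: "ptree \<Rightarrow> rtree" where
  "shape (PNode ts) = Node (mset (map shape ts))"

primrec vertices :: "ptree \<Rightarrow> nat list set" where
  "vertices (PNode ts) = insert [] (\<Union>i<length ts. (#) i ` (map vertices ts ! i))"

primrec subtree_at :: "ptree \<Rightarrow> nat list \<Rightarrow> ptree" where
  "subtree_at t [] = t"
| "subtree_at t (i # v) = subtree_at (branches t ! i) v"

definition edges :: "ptree \<Rightarrow> nat list set" where
  "edges t = vertices t - {[]}"

definition leaves :: "ptree \<Rightarrow> nat list set" where
  "leaves t = {v \<in> vertices t. \<forall>i. v @ [i] \<notin> vertices t}"

text \<open>
  The path from the root to the leaf \<open>l\<close> consists of the edges that are prefixes of \<open>l\<close>.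
\<close>

definition admissible_cuts :: "ptree \<Rightarrow> nat list set set" where
  "admissible_cuts t =
     {c. c \<noteq> {} \<and> c \<subseteq> edges t \<and> (\<forall>l\<in>leaves t. card {e \<in> c. prefix e l} \<le> 1)}"

text \<open>
  The component of the root after deleting the edges in \<open>c\<close>; the recursive calls use the edges
  of \<open>c\<close> inside the \<open>i\<close>-th branch, as addressed from the root of this branch.
\<close>

primrec root_component :: "ptree \<Rightarrow> nat list set \<Rightarrow> rtree" where
  "root_component (PNode ts) =
     (\<lambda>c. Node (mset (map (\<lambda>i. (map root_component ts ! i) {v. i # v \<in> c})
                          (filter (\<lambda>i. [i] \<notin> c) [0..<length ts]))))"

text \<open>Every component not containing the root hangs below exactly one deleted edge.\<close>

definition cut_forest :: "ptree \<Rightarrow> nat list set \<Rightarrow> forest" where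
  "cut_forest t c = image_mset (\<lambda>e. root_component (subtree_at t e) {v. e @ v \<in> c}) (mset_set c)"

text \<open>
  The coproduct below does not depend on the choice of the planar drawing.
\<close>

definition planar :: "rtree \<Rightarrow> ptree" where
  "planar \<tau> = (SOME t. shape t = \<tau>)"


section \<open>The Butcher--Connes--Kreimer Hopf algebra\<close>

text \<open>
  The free commutative algebra on the trees is the monoid algebra of the forests, with the
  convolution product of \<open>poly_mapping\<close>. Its tensor square is the monoid algebra of the pairs
  of forests, where the pair \<open>(F, G)\<close> stands for \<open>F \<otimes> G\<close>.
\<close>

type_synonym hopf = "forest \<Rightarrow>\<^sub>0 real"
type_synonym hopf2 = "(forest \<times> forest) \<Rightarrow>\<^sub>0 real"

definition basis :: "'a \<Rightarrow> ('a \<Rightarrow>\<^sub>0 real)" where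
  "basis k = Poly_Mapping.single k 1"

definition lin_ext :: "('a \<Rightarrow> 'b::real_vector) \<Rightarrow> ('a \<Rightarrow>\<^sub>0 real) \<Rightarrow> 'b" where
  "lin_ext f x = (\<Sum>k\<in>Poly_Mapping.keys x. Poly_Mapping.lookup x k *\<^sub>R f k)"

definition tensor :: "hopf \<Rightarrow> hopf \<Rightarrow> hopf2" where
  "tensor x y = lin_ext (\<lambda>F. lin_ext (\<lambda>G. basis (F, G)) y) x"

definition tensor_map :: "(hopf \<Rightarrow> hopf) \<Rightarrow> (hopf \<Rightarrow> hopf) \<Rightarrow> hopf2 \<Rightarrow> hopf2" where
  "tensor_map f g = lin_ext (\<lambda>(F, G). tensor (f (basis F)) (g (basis G)))"

definition hopf_mult :: "hopf2 \<Rightarrow> hopf" where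
  "hopf_mult = lin_ext (\<lambda>(F, G). basis F * basis G)"

definition counit :: "hopf \<Rightarrow> real" where
  "counit = lin_ext (\<lambda>F. if F = {#} then 1 else 0)"

definition tree_coproduct :: "rtree \<Rightarrow> hopf2" where
  "tree_coproduct \<tau> =
     basis ({#\<tau>#}, {#}) + basis ({#}, {#\<tau>#}) +
     (\<Sum>c\<in>admissible_cuts (planar \<tau>).
        basis (cut_forest (planar \<tau>) c, {#root_component (planar \<tau>) c#}))"

definition coproduct :: "hopf \<Rightarrow> hopf2" where
  "coproduct = lin_ext (\<lambda>F. \<Prod>\<tau>\<in>#F. tree_coproduct \<tau>)"

definition antipode :: "hopf \<Rightarrow> hopf" where
  "antipode = (THE S. linear S \<and>
     (\<forall>x. hopf_mult (tensor_map S id (coproduct x)) = counit x *\<^sub>R 1) \<and>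
     (\<forall>x. hopf_mult (tensor_map id S (coproduct x)) = counit x *\<^sub>R 1))"


section \<open>The plus and minus maps\<close>

definition unital_algebra_endomorphism :: "(hopf \<Rightarrow> hopf) \<Rightarrow> bool" where
  "unital_algebra_endomorphism f \<longleftrightarrow>
     linear f \<and> f 1 = 1 \<and> (\<forall>x y. f (x * y) = f x * f y)"

definition half_id :: "hopf \<Rightarrow> hopf" where
  "half_id = (THE f. unital_algebra_endomorphism f \<and> hopf_mult \<circ> tensor_map f f \<circ> coproduct = id)"

definition signed_antipode :: "hopf \<Rightarrow> hopf" where
  "signed_antipode = lin_ext (\<lambda>F. (-1) ^ forest_nodes F *\<^sub>R antipode (basis F))"

definition minus_map :: "hopf \<Rightarrow> hopf" where
  "minus_map = hopf_mult \<circ> tensor_map signed_antipode id \<circ> coproduct \<circ> half_id"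

definition plus_map :: "hopf \<Rightarrow> hopf" where
  "plus_map = hopf_mult \<circ> tensor_map id (minus_map \<circ> antipode) \<circ> coproduct"


section \<open>Runge--Kutta schemes\<close>

text \<open>
  An \<open>s\<close>-stage scheme is given by coefficients \<open>A i j\<close> and \<open>b i\<close> with indices in \<open>{1..s}\<close>;
  values at other indices are irrelevant.
\<close>

definition consistent :: "nat \<Rightarrow> (nat \<Rightarrow> real) \<Rightarrow> bool" where
  "consistent s b \<longleftrightarrow> (\<Sum>i=1..s. b i) = 1"

definition explicit :: "nat \<Rightarrow> (nat \<Rightarrow> nat \<Rightarrow> real) \<Rightarrow> bool" where
  "explicit s A \<longleftrightarrow> (\<forall>i\<in>{1..s}. \<forall>j\<in>{1..s}. i \<le> j \<longrightarrow> A i j = 0)"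

definition rk_node :: "nat \<Rightarrow> (nat \<Rightarrow> nat \<Rightarrow> real) \<Rightarrow> nat \<Rightarrow> real" where
  "rk_node s A i = (\<Sum>j=1..s. A i j)"

primrec stage_weight :: "nat \<Rightarrow> (nat \<Rightarrow> nat \<Rightarrow> real) \<Rightarrow> rtree \<Rightarrow> nat \<Rightarrow> real" where
  "stage_weight s A (Node M) =
     (\<lambda>i. \<Sum>j=1..s. A i j * (\<Prod>w\<in>#image_mset (stage_weight s A) M. w j))"

definition tree_weight :: "nat \<Rightarrow> (nat \<Rightarrow> nat \<Rightarrow> real) \<Rightarrow> (nat \<Rightarrow> real) \<Rightarrow> rtree \<Rightarrow> real" where
  "tree_weight s A b \<tau> = (\<Sum>i=1..s. b i * (\<Prod>\<sigma>\<in>#subtrees \<tau>. stage_weight s A \<sigma> i))"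

definition elementary_weights ::
    "nat \<Rightarrow> (nat \<Rightarrow> nat \<Rightarrow> real) \<Rightarrow> (nat \<Rightarrow> real) \<Rightarrow> hopf \<Rightarrow> real" where
  "elementary_weights s A b = lin_ext (\<lambda>F. \<Prod>\<tau>\<in>#F. tree_weight s A b \<tau>)"


section \<open>Orders\<close>

text \<open>
  The conjunct \<open>\<psi> 1 = 1\<close> is the order condition for the empty tree.
\<close>

definition rk_order :: "(hopf \<Rightarrow> real) \<Rightarrow> enat" where
  "rk_order \<psi> = Sup {enat n | n.
     \<psi> 1 = 1 \<and> (\<forall>\<tau>. nodes \<tau> \<le> n \<longrightarrow> \<psi> (basis {#\<tau>#}) = 1 / real (tree_fact \<tau>))}"

definition antisymmetric_order :: "(hopf \<Rightarrow> real) \<Rightarrow> enat" where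
  "antisymmetric_order \<psi> = Sup {enat n | n.
     \<forall>\<tau>. nodes \<tau> \<le> n \<longrightarrow> \<psi> (plus_map (basis {#\<tau>#})) = 0}"

definition EES ::
    "nat \<Rightarrow> nat \<Rightarrow> (nat \<times> (nat \<Rightarrow> nat \<Rightarrow> real) \<times> (nat \<Rightarrow> real)) set" where
  "EES n m = {(s, A, b). consistent s b \<and> explicit s A \<and>
     rk_order (elementary_weights s A b) = enat n \<and>
     antisymmetric_order (elementary_weights s A b) = enat m}"

end

theory Submission
  imports Defs
begin

text \<open>
  Write \<open>f \<star> g = \<mu> \<circ> (f \<otimes> g) \<circ> \<Delta>\<close> for the convolution product, let \<open>\<psi>\<close> be the elementary weights
  function of the scheme and \<open>\<psi>\<inverse> = \<psi> \<circ> S\<close> its inverse, and let a bar denote the sign change by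
  \<open>(-1)\<^sup>|\<^sup>F\<^sup>|\<close> on forests. Composing a character with the half identity gives its square root,
  so that \<open>\<psi>\<^sup>- = \<psi> \<circ> (\<cdot>)\<^sup>-\<close> is the square root of \<open>bar (\<psi>\<inverse>) \<star> \<psi>\<close>, while \<open>\<psi>\<^sup>+ \<star> \<psi>\<^sup>- = \<psi>\<close>. If \<open>\<psi>\<^sup>+\<close>
  vanishes on the trees with at most \<open>n\<close> vertices, then up to that degree \<open>\<psi> = \<psi>\<^sup>-\<close>, hence
  \<open>\<psi> \<star> \<psi> = bar (\<psi>\<inverse>) \<star> \<psi>\<close>, hence \<open>\<psi> = bar (\<psi>\<inverse>)\<close>, hence \<open>bar \<psi> \<star> \<psi> = \<epsilon>\<close>: the scheme followed by
  itself with the opposite step size is the identity (\<open>antisymmetric_character\<close>).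

  Evaluating \<open>bar \<psi> \<star> \<psi>\<close> on a tree by the recursion
  \<open>\<Delta> [\<tau>\<^sub>1, \<dots>, \<tau>\<^sub>k] = [\<tau>\<^sub>1, \<dots>, \<tau>\<^sub>k] \<otimes> \<emptyset> + (Id \<otimes> B\<^sub>+) (\<Delta> \<tau>\<^sub>1 \<cdots> \<Delta> \<tau>\<^sub>k)\<close> turns this into the statement that the
  scheme \<open>(A, b)\<close> and its adjoint, whose matrix is \<open>b\<^sub>j - a\<^sub>i\<^sub>j\<close>, have the same weights on small trees
  (\<open>adjoint_scheme\<close>). For three explicit stages, put \<open>p = b\<^sub>2 c\<^sub>2\<^sup>2 + b\<^sub>3 c\<^sub>3\<^sup>2\<close> and \<open>q = b\<^sub>3 a\<^sub>3\<^sub>2 c\<^sub>2\<close>. The tree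
  with two vertices gives \<open>b\<^sub>2 c\<^sub>2 + b\<^sub>3 c\<^sub>3 = 1/2\<close>. The path with four vertices has weight \<open>0\<close> in the
  scheme and \<open>2 q - 1/4\<close> in the adjoint, so \<open>q = 1/8\<close>; two other trees with four vertices give
  \<open>p = c\<^sub>3/4 + 1/8\<close> and \<open>p = c\<^sub>2/4 + 1/4\<close>. Together with \<open>b\<^sub>1 + b\<^sub>2 + b\<^sub>3 = 1\<close> these equations determine
  all coefficients in terms of \<open>x = b\<^sub>1\<close> (\<open>three_stage_equations\<close>).

  The work in between shows that the antipode and the half identity, which are given by unique
  descriptions, do exist with their defining properties. The antipode needs coassociativity, which,
  like the counit laws and the grading, follows from the recursion for \<open>\<Delta>\<close> by induction on trees. The
  recursion itself is derived from the description of \<open>\<Delta>\<close> by admissible cuts.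
\<close>

section \<open>Linear maps and algebra morphisms on monoid algebras\<close>

lemma lookup_scaleR: "Poly_Mapping.lookup (r *\<^sub>R x) k = r *\<^sub>R Poly_Mapping.lookup x k"
  by (simp add: scaleR_poly_mapping_def)

lemma scaleR_eq_single_times:
  fixes x :: "'a::monoid_add \<Rightarrow>\<^sub>0 'b::real_algebra_1"
  shows "r *\<^sub>R x = Poly_Mapping.single 0 (of_real r) * x"
  unfolding mult_map_scale_conv_mult[symmetric]
  by (rule poly_mapping_eqI) (simp add: lookup_scaleR Poly_Mapping.map.rep_eq when_def scaleR_conv_of_real)

text \<open>
  Both the Hopf algebra and the real numbers occur as targets of convolutions. With this
  instance they share the classes \<^class>\<open>real_algebra_1\<close> and \<^class>\<open>comm_ring_1\<close>.
\<close>

instance poly_mapping :: (comm_monoid_add, "{real_algebra_1,comm_ring_1}") real_algebra_1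
  by standard (simp_all add: scaleR_eq_single_times ac_simps)

lemma lin_ext_superset:
  assumes "finite S" "Poly_Mapping.keys x \<subseteq> S"
  shows "lin_ext f x = (\<Sum>k\<in>S. Poly_Mapping.lookup x k *\<^sub>R f k)"
  unfolding lin_ext_def
  by (rule sum.mono_neutral_left) (use assms in \<open>auto simp: in_keys_iff\<close>)

lemma linear_lin_ext [simp]: "linear (lin_ext f)"
proof (rule linearI)
  fix x y :: "'a \<Rightarrow>\<^sub>0 real" and r :: real
  let ?S = "Poly_Mapping.keys x \<union> Poly_Mapping.keys y"
  have "lin_ext f (x + y) = (\<Sum>k\<in>?S. Poly_Mapping.lookup (x + y) k *\<^sub>R f k)"
    by (rule lin_ext_superset) (use Poly_Mapping.keys_add[of x y] in auto)
  also have "\<dots> = lin_ext f x + lin_ext f y"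
    by (simp add: lookup_add scaleR_add_left sum.distrib lin_ext_superset[of ?S])
  finally show "lin_ext f (x + y) = lin_ext f x + lin_ext f y" .
  have "lin_ext f (r *\<^sub>R x) = (\<Sum>k\<in>Poly_Mapping.keys x. Poly_Mapping.lookup (r *\<^sub>R x) k *\<^sub>R f k)"
    by (rule lin_ext_superset) (auto simp: in_keys_iff lookup_scaleR)
  then show "lin_ext f (r *\<^sub>R x) = r *\<^sub>R lin_ext f x"
    by (simp add: lookup_scaleR lin_ext_def scaleR_sum_right)
qed

lemma lin_ext_basis [simp]: "lin_ext f (basis k) = f k"
  by (simp add: lin_ext_def basis_def)

lemma keys_basis [simp]: "Poly_Mapping.keys (basis k) = {k}"
  by (simp add: basis_def)

lemma lin_ext_basis_id: "lin_ext basis x = x"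
proof (rule poly_mapping_eqI)
  fix j
  have "Poly_Mapping.lookup (lin_ext basis x) j
      = (\<Sum>k\<in>Poly_Mapping.keys x. if j = k then Poly_Mapping.lookup x k else 0)"
    unfolding lin_ext_def lookup_sum
    by (rule sum.cong) (auto simp: lookup_scaleR basis_def lookup_single when_def)
  also have "\<dots> = Poly_Mapping.lookup x j"
    by (simp add: in_keys_iff)
  finally show "Poly_Mapping.lookup (lin_ext basis x) j = Poly_Mapping.lookup x j" .
qed

lemma linear_lin_ext_comp:
  assumes "linear f"
  shows "f (lin_ext g x) = lin_ext (\<lambda>k. f (g k)) x"
  unfolding lin_ext_def by (simp add: linear_sum[OF assms] linear_scale[OF assms])

lemma linear_eq_on_basis:
  assumes "linear f" "linear g" "\<And>k. k \<in> Poly_Mapping.keys x \<Longrightarrow> f (basis k) = g (basis k)"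
  shows "f x = g x"
proof -
  have "f x = lin_ext (\<lambda>k. f (basis k)) x" "g x = lin_ext (\<lambda>k. g (basis k)) x"
    using linear_lin_ext_comp[OF assms(1), of basis x] linear_lin_ext_comp[OF assms(2), of basis x]
    by (simp_all add: lin_ext_basis_id)
  then show ?thesis
    by (simp add: lin_ext_def assms(3) cong: sum.cong)
qed

lemma linear_ext_basis:
  assumes "linear f" "linear g" "\<And>k. f (basis k) = g (basis k)"
  shows "f = g"
  using linear_eq_on_basis[OF assms(1,2)] assms(3) by blast

lemma lin_ext_cong:
  assumes "\<And>k. k \<in> Poly_Mapping.keys x \<Longrightarrow> f k = g k"
  shows "lin_ext f x = lin_ext g x"
  by (simp add: lin_ext_def assms cong: sum.cong)

lemma basis_add: "basis (k + l) = basis k * basis l"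
  by (simp add: basis_def mult_single)

lemma basis_zero: "basis 0 = 1"
  by (simp add: basis_def)

lemma linear_mult_left: "linear f \<Longrightarrow> linear (\<lambda>x. f x * (c::'b::real_algebra_1))"
  by (auto intro!: linearI simp: linear_add linear_scale distrib_right)

lemma linear_mult_right: "linear f \<Longrightarrow> linear (\<lambda>x. (c::'b::real_algebra_1) * f x)"
  by (auto intro!: linearI simp: linear_add linear_scale distrib_left)

lemma linear_comp: "linear f \<Longrightarrow> linear g \<Longrightarrow> linear (\<lambda>x. f (g x))"
  using linear_compose[of g f] by (simp add: o_def)

definition alg_hom :: "('a::real_algebra_1 \<Rightarrow> 'b::real_algebra_1) \<Rightarrow> bool" where
  "alg_hom f \<longleftrightarrow> linear f \<and> f 1 = 1 \<and> (\<forall>x y. f (x * y) = f x * f y)"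

lemma alg_homD:
  assumes "alg_hom f"
  shows "linear f" "f 1 = 1" "f (x * y) = f x * f y"
  using assms by (auto simp: alg_hom_def)

lemma alg_hom_lin_ext:
  fixes f :: "'a::comm_monoid_add \<Rightarrow> 'b::{real_algebra_1,comm_ring_1}"
  assumes "f 0 = 1" "\<And>k l. f (k + l) = f k * f l"
  shows "alg_hom (lin_ext f)"
  unfolding alg_hom_def
proof (intro conjI allI)
  show "lin_ext f 1 = 1"
    by (simp flip: basis_zero add: assms)
  fix x y
  show "lin_ext f (x * y) = lin_ext f x * lin_ext f y"
  proof (rule linear_eq_on_basis[where x = x])
    fix k
    show "lin_ext f (basis k * y) = lin_ext f (basis k) * lin_ext f y"
    proof (rule linear_eq_on_basis[where x = y])
      fix l
      show "lin_ext f (basis k * basis l) = lin_ext f (basis k) * lin_ext f (basis l)"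
        by (simp flip: basis_add add: assms)
    qed (rule linear_comp[OF linear_lin_ext linear_mult_right[OF linear_ident]]
          linear_mult_right[OF linear_lin_ext])+
  qed (rule linear_comp[OF linear_lin_ext linear_mult_left[OF linear_ident]]
        linear_mult_left[OF linear_lin_ext])+
qed simp

lemma alg_hom_prod_mset:
  fixes f :: "'a::{real_algebra_1,comm_ring_1} \<Rightarrow> 'b::{real_algebra_1,comm_ring_1}"
  assumes "alg_hom f"
  shows "f (\<Prod>x\<in>#M. g x) = (\<Prod>x\<in>#M. f (g x))"
  by (induction M) (simp_all add: alg_homD[OF assms])

lemma alg_hom_comp: "alg_hom f \<Longrightarrow> alg_hom g \<Longrightarrow> alg_hom (\<lambda>x. f (g x))"
  by (simp add: alg_hom_def linear_comp)

lemma alg_hom_id: "alg_hom id"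
  using linear_ident by (simp add: alg_hom_def id_def)

lemma basis_forest: "basis (F :: forest) = (\<Prod>\<tau>\<in>#F. basis {#\<tau>#})"
proof (induction F)
  case empty
  then show ?case
    using basis_zero[where 'a=forest] by simp
next
  case (add \<tau> F)
  then show ?case
    by (simp only: add_mset_add_single[of \<tau> F] basis_add) simp
qed

lemma alg_hom_forest:
  fixes f :: "hopf \<Rightarrow> 'b::{real_algebra_1,comm_ring_1}"
  assumes "alg_hom f"
  shows "f (basis F) = (\<Prod>\<tau>\<in>#F. f (basis {#\<tau>#}))"
  by (subst basis_forest) (rule alg_hom_prod_mset[OF assms])

lemma alg_hom_ext_trees:
  fixes f :: "hopf \<Rightarrow> 'b::{real_algebra_1,comm_ring_1}"
  assumes "alg_hom f" "alg_hom g" "\<And>\<tau>. f (basis {#\<tau>#}) = g (basis {#\<tau>#})"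
  shows "f = g"
proof (rule linear_ext_basis)
  fix F
  show "f (basis F) = g (basis F)"
    using alg_hom_forest[OF assms(1), of F] alg_hom_forest[OF assms(2), of F] assms(3) by simp
qed (fact alg_homD(1)[OF assms(1)] alg_homD(1)[OF assms(2)])+

text \<open>
  As the forests form the free commutative monoid on the trees, every algebra morphism on the Hopf
  algebra has this form.
\<close>

definition on_trees :: "(rtree \<Rightarrow> 'b) \<Rightarrow> hopf \<Rightarrow> 'b::{real_algebra_1,comm_ring_1}" where
  "on_trees f = lin_ext (\<lambda>F. \<Prod>\<tau>\<in>#F. f \<tau>)"

lemma alg_hom_on_trees: "alg_hom (on_trees f)"
  unfolding on_trees_def by (rule alg_hom_lin_ext) simp_all

lemma on_trees_basis [simp]: "on_trees f (basis F) = (\<Prod>\<tau>\<in>#F. f \<tau>)"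
  by (simp add: on_trees_def)

text \<open>
  This is \<open>\<mu> \<circ> (f \<otimes> g)\<close> for any commutative target algebra and any two monoids. As the target is
  commutative, it is an algebra morphism when \<open>f\<close> and \<open>g\<close> are.
\<close>

definition pairing :: "(('a \<Rightarrow>\<^sub>0 real) \<Rightarrow> 'c) \<Rightarrow> (('b \<Rightarrow>\<^sub>0 real) \<Rightarrow> 'c)
    \<Rightarrow> (('a \<times> 'b) \<Rightarrow>\<^sub>0 real) \<Rightarrow> 'c::{real_algebra_1,comm_ring_1}" where
  "pairing f g = lin_ext (\<lambda>(k, l). f (basis k) * g (basis l))"

lemma linear_pairing [simp]: "linear (pairing f g)"
  by (simp add: pairing_def)

lemma pairing_basis [simp]: "pairing f g (basis (k, l)) = f (basis k) * g (basis l)"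
  by (simp add: pairing_def)

lemma alg_hom_pairing:
  assumes "alg_hom f" "alg_hom g"
  shows "alg_hom (pairing f g)"
  unfolding pairing_def
  by (rule alg_hom_lin_ext)
     (auto simp: zero_prod_def basis_zero basis_add alg_homD[OF assms(1)] alg_homD[OF assms(2)])

lemma alg_hom_apply_pairing:
  assumes "alg_hom h"
  shows "h (pairing f g x) = pairing (\<lambda>y. h (f y)) (\<lambda>y. h (g y)) x"
  unfolding pairing_def linear_lin_ext_comp[OF alg_homD(1)[OF assms]]
  by (auto intro!: lin_ext_cong simp: alg_homD[OF assms])

lemma hopf_mult_tensor: "hopf_mult (tensor x y) = x * y"
proof -
  have "hopf_mult (tensor x y) = lin_ext (\<lambda>F. lin_ext (\<lambda>G. basis F * basis G) y) x"
    by (simp add: hopf_mult_def tensor_def linear_lin_ext_comp)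
  also have "\<dots> = x * y"
    by (simp add: linear_lin_ext_comp[OF linear_mult_right[OF linear_ident], symmetric]
        linear_lin_ext_comp[OF linear_mult_left[OF linear_ident], symmetric] lin_ext_basis_id)
  finally show ?thesis .
qed

lemma hopf_mult_tensor_map: "hopf_mult (tensor_map f g x) = pairing f g x"
  unfolding tensor_map_def linear_lin_ext_comp[OF linear_lin_ext, folded hopf_mult_def] hopf_mult_def pairing_def
  unfolding linear_lin_ext_comp[OF linear_lin_ext]
  by (rule lin_ext_cong) (auto simp: hopf_mult_tensor simp flip: hopf_mult_def)

section \<open>A recursion for the coproduct\<close>

text \<open>This is \<open>Id \<otimes> B\<^sub>+\<close>, where \<open>B\<^sub>+\<close> joins the trees of a forest to a new root.\<close>

definition graft_right :: "hopf2 \<Rightarrow> hopf2" where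
  "graft_right = lin_ext (\<lambda>(P, R). basis (P, {#Node R#}))"

lemma linear_graft_right [simp]: "linear graft_right"
  by (simp add: graft_right_def)

lemma graft_right_basis [simp]: "graft_right (basis (P, R)) = basis (P, {#Node R#})"
  by (simp add: graft_right_def)

lemma graft_right_basis_pair: "graft_right (basis k) = basis (fst k, {#Node (snd k)#})"
  by (cases k) simp

lemma shape_planar: "shape (planar \<tau>) = \<tau>"
proof -
  have "\<exists>t. shape t = \<tau>"
  proof (induction \<tau>)
    case (Node M)
    then obtain f where f: "\<And>\<sigma>. \<sigma> \<in># M \<Longrightarrow> shape (f \<sigma>) = \<sigma>"
      by metis
    obtain xs where xs: "mset xs = M"
      using ex_mset by blast
    have "map shape (map f xs) = xs"
      using f xs by (auto intro!: map_idI)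
    then have "shape (PNode (map f xs)) = Node M"
      by (simp add: xs del: map_map)
    then show ?case ..
  qed
  then show ?thesis
    unfolding planar_def by (rule someI_ex)
qed

lemma vertices_PNode: "vertices (PNode ts) = insert [] (\<Union>i<length ts. (#) i ` vertices (ts ! i))"
  by simp

declare vertices.simps [simp del]

lemma root_in_vertices [simp]: "[] \<in> vertices t"
  by (cases t) (simp add: vertices_PNode)

lemma finite_vertices [simp]: "finite (vertices t)"
proof (induction t)
  case (PNode ts)
  then show ?case
    by (auto simp: vertices_PNode)
qed

lemma leaf_above_vertex:
  assumes "v \<in> vertices t"
  obtains l where "l \<in> leaves t" "prefix v l"
proof -
  let ?W = "{w \<in> vertices t. prefix v w}"
  have "Max (length ` ?W) \<in> length ` ?W"
    using assms by (intro Max_in) auto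
  then obtain l where l: "l \<in> ?W" "length l = Max (length ` ?W)"
    by auto
  have "l @ [i] \<notin> vertices t" for i
  proof
    assume "l @ [i] \<in> vertices t"
    then have "l @ [i] \<in> ?W"
      using l by (auto simp: prefix_prefix)
    then have "length (l @ [i]) \<le> length l"
      unfolding l by (intro Max_ge finite_imageI imageI) auto
    then show False by simp
  qed
  then show ?thesis
    using l that by (auto simp: leaves_def)
qed

text \<open>
  As every vertex lies below some leaf, a set of edges meets each path at most once iff it is
  prefix-free. Besides the admissible cuts, this leaves two prefix-free sets of vertices: the empty
  set and the set of the root, which stand for the terms \<open>\<emptyset> \<otimes> \<tau>\<close> and \<open>\<tau> \<otimes> \<emptyset>\<close> of the coproduct.
  Treating all terms alike makes the sum multiplicative over the branches.
\<close>

definition antichains :: "ptree \<Rightarrow> nat list set set" where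
  "antichains t = {c. c \<subseteq> vertices t \<and> (\<forall>e\<in>c. \<forall>e'\<in>c. prefix e e' \<longrightarrow> e = e')}"

lemma finite_antichains [simp]: "finite (antichains t)"
  by (rule finite_subset[of _ "Pow (vertices t)"]) (auto simp: antichains_def)

lemma finite_antichain: "c \<in> antichains t \<Longrightarrow> finite c"
  unfolding antichains_def mem_Collect_eq by (elim conjE finite_subset) simp

lemma antichain_root: "c \<in> antichains t \<Longrightarrow> [] \<in> c \<Longrightarrow> c = {[]}"
proof -
  assume "c \<in> antichains t" and root: "[] \<in> c"
  then have "e = []" if "e \<in> c" for e
    using that Nil_prefix[of e] unfolding antichains_def mem_Collect_eq by metis
  with root show "c = {[]}"
    by blast
qed

lemma admissible_cuts_antichains: "admissible_cuts t = antichains t - {{}, {[]}}"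
proof (intro equalityI subsetI)
  fix c
  assume c: "c \<in> admissible_cuts t"
  then have sub: "c \<subseteq> vertices t" "c \<noteq> {}" "[] \<notin> c"
    by (auto simp: admissible_cuts_def edges_def)
  have "e = e'" if e: "e \<in> c" "e' \<in> c" "prefix e e'" for e e'
  proof -
    obtain l where l: "l \<in> leaves t" "prefix e' l"
      using leaf_above_vertex sub e by blast
    have "card {d \<in> c. prefix d l} \<le> 1"
      using c l by (auto simp: admissible_cuts_def)
    moreover have "finite {d \<in> c. prefix d l}"
      using sub(1) finite_subset by fastforce
    moreover have "e \<in> {d \<in> c. prefix d l}" "e' \<in> {d \<in> c. prefix d l}"
      using e(1,2) l(2) prefix_order.trans[OF e(3) l(2)] by simp_all
    ultimately show ?thesis
      by (metis card_le_Suc0_iff_eq One_nat_def)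
  qed
  then show "c \<in> antichains t - {{}, {[]}}"
    using sub by (auto simp: antichains_def)
next
  fix c
  assume c: "c \<in> antichains t - {{}, {[]}}"
  then have "[] \<notin> c"
    using antichain_root by blast
  moreover have "card {d \<in> c. prefix d l} \<le> 1" for l
  proof -
    have "d = d'" if "d \<in> c" "d' \<in> c" "prefix d l" "prefix d' l" for d d'
      using that c prefix_same_cases[OF that(3,4)] by (auto simp: antichains_def)
    then show ?thesis
      using finite_antichain[of c t] c by (auto simp: card_le_Suc0_iff_eq)
  qed
  ultimately show "c \<in> admissible_cuts t"
    using c by (auto simp: admissible_cuts_def edges_def antichains_def)
qed

abbreviation below :: "nat \<Rightarrow> nat list set \<Rightarrow> nat list set" where
  "below i c \<equiv> {v. i # v \<in> c}"

lemma mset_map_filter_upt: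
  "mset (map g (filter p [0..<n])) = (\<Sum>i<n. if p i then {#g i#} else {#})"
  by (induction n) auto

lemma root_component_PNode:
  "root_component (PNode ts) c =
     Node (\<Sum>i<length ts. if [] \<in> below i c then {#} else {#root_component (ts ! i) (below i c)#})"
proof -
  have "(\<Sum>i<length ts. if [i] \<notin> c then {#(map root_component ts ! i) (below i c)#} else {#})
    = (\<Sum>i<length ts. if [] \<in> below i c then {#} else {#root_component (ts ! i) (below i c)#})"
    by (rule sum.cong) auto
  then show ?thesis
    by (simp only: root_component.simps mset_map_filter_upt)
qed

lemma mset_map_nth: "mset (map f ts) = (\<Sum>i<length ts. {#f (ts ! i)#})"
  by (induction ts rule: rev_induct) (simp_all add: nth_append)

lemma root_component_no_edges: "c \<subseteq> {[]} \<Longrightarrow> root_component t c = shape t"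
proof (induction t arbitrary: c)
  case (PNode ts)
  have "below i c = {}" for i
    using PNode.prems by auto
  moreover have "root_component (ts ! i) {} = shape (ts ! i)" if "i < length ts" for i
    using PNode.IH that by simp
  ultimately show ?case
    unfolding root_component_PNode shape.simps mset_map_nth
    by (intro arg_cong[where f = Node] sum.cong) auto
qed

lemma image_mset_mset_set: "finite A \<Longrightarrow> image_mset f (mset_set A) = (\<Sum>x\<in>A. {#f x#})"
  by (induction A rule: finite_induct) auto

lemma below_antichain:
  assumes "c \<in> antichains (PNode ts)" "i < length ts"
  shows "below i c \<in> antichains (ts ! i)"
  using assms by (fastforce simp: antichains_def vertices_PNode)

lemma antichain_eq_Union:
  assumes "c \<in> antichains (PNode ts)" "[] \<notin> c"
  shows "c = (\<Union>i<length ts. (#) i ` below i c)"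
  using assms by (fastforce simp: antichains_def vertices_PNode)

text \<open>
  A branch cut off at its own root contributes the whole branch, which is also the cut forest of
  the branch for the antichain of its root; so no case distinction is needed.
\<close>

lemma cut_forest_PNode:
  assumes c: "c \<in> antichains (PNode ts)" "[] \<notin> c"
  shows "cut_forest (PNode ts) c = (\<Sum>i<length ts. cut_forest (ts ! i) (below i c))"
proof -
  let ?f = "\<lambda>e. root_component (subtree_at (PNode ts) e) {v. e @ v \<in> c}"
  have fin: "finite (below i c)" if "i < length ts" for i
    using finite_antichain below_antichain c that by blast
  have "cut_forest (PNode ts) c = (\<Sum>e\<in>c. {#?f e#})"
    using c by (simp add: cut_forest_def image_mset_mset_set finite_antichain)
  also have "\<dots> = (\<Sum>e\<in>(\<Union>i<length ts. (#) i ` below i c). {#?f e#})"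
    using antichain_eq_Union[OF c] by (rule arg_cong)
  also have "\<dots> = (\<Sum>i<length ts. \<Sum>e\<in>(#) i ` below i c. {#?f e#})"
    by (rule sum.UNION_disjoint) (use fin in auto)
  also have "\<dots> = (\<Sum>i<length ts. cut_forest (ts ! i) (below i c))"
    using fin by (intro sum.cong) (simp_all add: sum.reindex cut_forest_def image_mset_mset_set)
  finally show ?thesis .
qed

text \<open>
  The antichain consisting of the root cuts off the whole tree and leaves nothing, although the
  function \<^const>\<open>root_component\<close> cannot express this.
\<close>

definition cut_pair :: "ptree \<Rightarrow> nat list set \<Rightarrow> forest \<times> forest" where
  "cut_pair t c = (cut_forest t c, if [] \<in> c then {#} else {#root_component t c#})"

definition cut_sum :: "ptree \<Rightarrow> hopf2" where
  "cut_sum t = (\<Sum>c\<in>antichains t. basis (cut_pair t c))"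

lemma cut_pair_root: "cut_pair t {[]} = ({#shape t#}, {#})"
  by (simp add: cut_pair_def cut_forest_def root_component_no_edges)

lemma cut_pair_empty: "cut_pair t {} = ({#}, {#shape t#})"
  by (simp add: cut_pair_def cut_forest_def root_component_no_edges)

lemma tree_coproduct_cut_sum: "tree_coproduct \<tau> = cut_sum (planar \<tau>)"
proof -
  let ?t = "planar \<tau>"
  have "{[]} \<in> antichains ?t" "{} \<in> antichains ?t"
    by (auto simp: antichains_def)
  then have "antichains ?t = insert {[]} (insert {} (admissible_cuts ?t))"
    unfolding admissible_cuts_antichains by auto
  moreover have "{[]} \<notin> insert {} (admissible_cuts ?t)" "{} \<notin> admissible_cuts ?t"
    by (auto simp: admissible_cuts_antichains)
  moreover have "finite (admissible_cuts ?t)"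
    by (simp add: admissible_cuts_antichains)
  moreover have "cut_pair ?t c = (cut_forest ?t c, {#root_component ?t c#})"
    if "c \<in> admissible_cuts ?t" for c
    using that by (auto simp: cut_pair_def admissible_cuts_def edges_def)
  ultimately show ?thesis
    by (simp add: cut_sum_def tree_coproduct_def cut_pair_root cut_pair_empty shape_planar add.assoc)
qed

lemma prod_basis: "(\<Prod>i\<in>I. basis (f i)) = basis (\<Sum>i\<in>I. f i)"
  by (induction I rule: infinite_finite_induct) (simp_all add: basis_zero basis_add)

lemma prod_mset_nth: "(\<Prod>i<length ts. f (ts ! i)) = (\<Prod>t\<in>#mset ts. f t)"
proof -
  have "(\<Prod>t\<in>#mset ts. f t) = prod_list (map f ts)"
    by (simp add: prod_mset_prod_list flip: mset_map)
  also have "\<dots> = (\<Prod>i<length ts. f (ts ! i))"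
    unfolding prod.list_conv_set_nth by (rule prod.cong) auto
  finally show ?thesis ..
qed

lemma Union_below:
  assumes "g \<in> (\<Pi>\<^sub>E i\<in>{..<length ts}. antichains (ts ! i))"
  shows "(\<Union>i<length ts. (#) i ` g i) \<in> antichains (PNode ts)"
    "i < length ts \<Longrightarrow> below i (\<Union>i<length ts. (#) i ` g i) = g i"
proof -
  have g: "g i \<in> antichains (ts ! i)" if "i < length ts" for i
    using assms that by auto
  show "(\<Union>i<length ts. (#) i ` g i) \<in> antichains (PNode ts)"
    using g unfolding antichains_def vertices_PNode by fastforce
qed auto

text \<open>
  An antichain of a tree other than that of its root is a free choice of one antichain in each
  branch, where choosing the root of the branch means cutting the edge above it. Hence the sum
  over such antichains is the expansion of the product of the sums over the branches.
\<close>

lemma cut_sum_PNode: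
  "cut_sum (PNode ts) = basis ({#shape (PNode ts)#}, {#}) + graft_right (\<Prod>t\<in>#mset ts. cut_sum t)"
proof -
  let ?n = "length ts" and ?t = "PNode ts"
  let ?G = "\<Pi>\<^sub>E i\<in>{..<?n}. antichains (ts ! i)"
  let ?p = "\<lambda>g. \<Sum>i<?n. cut_pair (ts ! i) (g i)"
  have "(\<Prod>t\<in>#mset ts. cut_sum t) = (\<Prod>i<?n. \<Sum>c\<in>antichains (ts ! i). basis (cut_pair (ts ! i) c))"
    by (simp add: cut_sum_def flip: prod_mset_nth)
  also have "\<dots> = (\<Sum>g\<in>?G. basis (?p g))"
    by (simp add: prod_sum_PiE prod_basis)
  finally have "graft_right (\<Prod>t\<in>#mset ts. cut_sum t)
      = (\<Sum>g\<in>?G. basis (fst (?p g), {#Node (snd (?p g))#}))"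
    by (simp only: linear_sum[OF linear_graft_right] graft_right_basis_pair)
  also have "\<dots> = (\<Sum>c\<in>antichains ?t - {{[]}}. basis (cut_pair ?t c))"
  proof (rule sum.reindex_bij_witness[where j = "\<lambda>g. \<Union>i<?n. (#) i ` g i"
        and i = "\<lambda>c. \<lambda>i\<in>{..<?n}. below i c"])
    fix c
    assume "c \<in> antichains ?t - {{[]}}"
    then have c: "c \<in> antichains ?t" "[] \<notin> c"
      using antichain_root by auto
    show "(\<lambda>i\<in>{..<?n}. below i c) \<in> ?G"
      using below_antichain c by simp
    show "(\<Union>i<?n. (#) i ` (\<lambda>i\<in>{..<?n}. below i c) i) = c"
      using antichain_eq_Union[OF c] by simp
  next
    fix g
    assume g: "g \<in> ?G"
    let ?c = "\<Union>i<?n. (#) i ` g i"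
    have c: "?c \<in> antichains ?t" "[] \<notin> ?c"
      using Union_below(1)[OF g] by auto
    then show "?c \<in> antichains ?t - {{[]}}"
      by blast
    show "(\<lambda>i\<in>{..<?n}. below i ?c) = g"
    proof
      fix i
      show "(\<lambda>i\<in>{..<?n}. below i ?c) i = g i"
        using Union_below(2)[OF g, of i] PiE_arb[OF g, of i] by (cases "i < ?n") simp_all
    qed
    have "cut_forest ?t ?c = (\<Sum>i<?n. cut_forest (ts ! i) (g i))"
      unfolding cut_forest_PNode[OF c] using Union_below(2)[OF g] by (intro sum.cong) auto
    then have "fst (cut_pair ?t ?c) = fst (?p g)"
      unfolding cut_pair_def fst_sum fst_conv .
    moreover have "root_component ?t ?c
        = Node (\<Sum>i<?n. if [] \<in> g i then {#} else {#root_component (ts ! i) (g i)#})"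
      unfolding root_component_PNode using Union_below(2)[OF g]
      by (intro arg_cong[where f = Node] sum.cong) auto
    then have "snd (cut_pair ?t ?c) = {#Node (snd (?p g))#}"
      unfolding cut_pair_def snd_sum snd_conv using c(2) by (simp only: if_False)
    ultimately have "cut_pair ?t ?c = (fst (?p g), {#Node (snd (?p g))#})"
      unfolding prod_eq_iff fst_conv snd_conv by (rule conjI)
    then show "basis (cut_pair ?t ?c) = basis (fst (?p g), {#Node (snd (?p g))#})"
      by (rule arg_cong)
  qed
  finally have "graft_right (\<Prod>t\<in>#mset ts. cut_sum t) = \<dots>" .
  moreover have "{[]} \<in> antichains ?t"
    by (auto simp: antichains_def)
  ultimately show ?thesis
    by (simp add: cut_sum_def sum.remove[of "antichains ?t" "{[]}"] cut_pair_root del: shape.simps)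
qed

text \<open>
  The recursion refers to the shape only; this shows that the coproduct does not depend on the
  planar drawing.
\<close>

primrec rec_coproduct :: "rtree \<Rightarrow> hopf2" where
  "rec_coproduct (Node M) =
     basis ({#Node M#}, {#}) + graft_right (\<Prod>\<^sub># (image_mset rec_coproduct M))"

lemma cut_sum_eq_rec_coproduct: "cut_sum t = rec_coproduct (shape t)"
proof (induction t)
  case (PNode ts)
  then have "image_mset cut_sum (mset ts) = image_mset rec_coproduct (mset (map shape ts))"
    by (auto simp: image_mset.compositionality intro!: image_mset_cong)
  then show ?case
    by (simp add: cut_sum_PNode)
qed

lemma tree_coproduct_Node:
  "tree_coproduct (Node M) =
     basis ({#Node M#}, {#}) + graft_right (\<Prod>\<tau>\<in>#M. tree_coproduct \<tau>)"
proof -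
  have "tree_coproduct = rec_coproduct"
    by (simp add: fun_eq_iff tree_coproduct_cut_sum cut_sum_eq_rec_coproduct shape_planar)
  then show ?thesis
    by simp
qed

section \<open>Convolution\<close>

lemma coproduct_on_trees: "coproduct = on_trees tree_coproduct"
  by (simp add: coproduct_def on_trees_def)

lemma alg_hom_coproduct: "alg_hom coproduct"
  by (simp add: coproduct_on_trees alg_hom_on_trees)

lemmas linear_coproduct = alg_homD(1)[OF alg_hom_coproduct]

lemma coproduct_tree: "coproduct (basis {#\<tau>#}) = tree_coproduct \<tau>"
  by (simp add: coproduct_on_trees)

lemma coproduct_Node:
  "coproduct (basis {#Node M#}) = basis ({#Node M#}, {#}) + graft_right (coproduct (basis M))"
  by (simp add: coproduct_on_trees tree_coproduct_Node)

text \<open>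
  Structural induction for identities between algebra morphisms: on the forest of the branches
  they agree as soon as they agree on each branch.
\<close>

lemma alg_hom_ext_Node:
  fixes f g :: "hopf \<Rightarrow> 'b::{real_algebra_1,comm_ring_1}"
  assumes f: "alg_hom f" and g: "alg_hom g"
    and step: "\<And>M. f (basis M) = g (basis M) \<Longrightarrow> f (basis {#Node M#}) = g (basis {#Node M#})"
  shows "f = g"
proof (rule alg_hom_ext_trees[OF f g])
  fix \<tau>
  show "f (basis {#\<tau>#}) = g (basis {#\<tau>#})"
  proof (induction \<tau>)
    case (Node M)
    have "f (basis M) = g (basis M)"
      unfolding alg_hom_forest[OF f, of M] alg_hom_forest[OF g, of M]
      using Node.IH by (intro arg_cong[where f = prod_mset] image_mset_cong)
    then show ?case
      by (rule step)
  qed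
qed

type_synonym hopf3 = "(forest \<times> forest \<times> forest) \<Rightarrow>\<^sub>0 real"

definition graft3 :: "hopf3 \<Rightarrow> hopf3" where
  "graft3 = lin_ext (\<lambda>(P, Q, R). basis (P, Q, {#Node R#}))"

definition in1 :: "hopf \<Rightarrow> hopf3" where "in1 = lin_ext (\<lambda>P. basis (P, 0, 0))"
definition in3 :: "hopf \<Rightarrow> hopf3" where "in3 = lin_ext (\<lambda>R. basis (0, 0, R))"
definition in12 :: "hopf2 \<Rightarrow> hopf3" where "in12 = lin_ext (\<lambda>(P, Q). basis (P, Q, 0))"
definition in23 :: "hopf2 \<Rightarrow> hopf3" where "in23 = lin_ext (\<lambda>(Q, R). basis (0, Q, R))"

lemma alg_hom_ins: "alg_hom in1" "alg_hom in3" "alg_hom in12" "alg_hom in23"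
  unfolding in1_def in3_def in12_def in23_def
  by (auto intro!: alg_hom_lin_ext simp: basis_zero zero_prod_def simp flip: basis_add basis_zero)

lemma ins_basis [simp]:
  "in1 (basis P) = basis (P, 0, 0)" "in3 (basis R) = basis (0, 0, R)"
  "in12 (basis (P, Q)) = basis (P, Q, 0)" "in23 (basis (Q, R)) = basis (0, Q, R)"
  "graft3 (basis (P, Q, R)) = basis (P, Q, {#Node R#})"
  by (simp_all add: in1_def in3_def in12_def in23_def graft3_def)

lemma linear_ins: "linear in1" "linear in3" "linear in12" "linear in23" "linear graft3"
  using alg_hom_ins by (auto simp: alg_hom_def graft3_def)

text \<open>
  The two sides \<open>\<Delta> \<otimes> Id\<close> and \<open>Id \<otimes> \<Delta>\<close> of coassociativity. Being pairings of algebra morphisms,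
  they are algebra morphisms themselves.
\<close>

definition split_left :: "hopf2 \<Rightarrow> hopf3" where
  "split_left = pairing (\<lambda>x. in12 (coproduct x)) in3"

definition split_right :: "hopf2 \<Rightarrow> hopf3" where
  "split_right = pairing in1 (\<lambda>x. in23 (coproduct x))"

lemma alg_hom_split: "alg_hom split_left" "alg_hom split_right"
  unfolding split_left_def split_right_def
  by (rule alg_hom_pairing alg_hom_comp[OF alg_hom_ins(3) alg_hom_coproduct]
      alg_hom_comp[OF alg_hom_ins(4) alg_hom_coproduct] alg_hom_ins)+

lemmas linear_split = alg_hom_split[THEN alg_homD(1)]

lemma split_left_graft: "split_left (graft_right x) = graft3 (split_left x)"
proof (rule linear_eq_on_basis[where x = x])
  fix k :: "forest \<times> forest"
  obtain P R where k: "k = (P, R)"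
    by (cases k)
  have "in12 y * in3 (basis {#Node R#}) = graft3 (in12 y * in3 (basis R))" for y
  proof (rule linear_eq_on_basis[where x = y])
    fix l :: "forest \<times> forest"
    show "in12 (basis l) * in3 (basis {#Node R#}) = graft3 (in12 (basis l) * in3 (basis R))"
      by (cases l) (simp flip: basis_add)
  qed (intro linear_mult_left linear_ins linear_comp[OF linear_ins(5)])+
  then show "split_left (graft_right (basis k)) = graft3 (split_left (basis k))"
    by (simp add: k split_left_def del: ins_basis)
qed (intro linear_comp[OF linear_split(1)] linear_comp[OF linear_ins(5)] linear_graft_right
    linear_split)+

text \<open>
  The additional term comes from the summand \<open>[R] \<otimes> \<emptyset>\<close> of \<open>\<Delta> [R]\<close>.
\<close>

lemma split_right_graft: "split_right (graft_right x) = in12 (graft_right x) + graft3 (split_right x)"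
proof (rule linear_eq_on_basis[where x = x])
  fix k :: "forest \<times> forest"
  obtain P R where k: "k = (P, R)"
    by (cases k)
  have "in1 (basis P) * in23 (graft_right y) = graft3 (in1 (basis P) * in23 y)" for y
  proof (rule linear_eq_on_basis[where x = y])
    fix l :: "forest \<times> forest"
    show "in1 (basis P) * in23 (graft_right (basis l)) = graft3 (in1 (basis P) * in23 (basis l))"
      by (cases l) (simp flip: basis_add)
  qed (intro linear_mult_right linear_ins linear_comp[OF linear_ins(4)]
      linear_comp[OF linear_ins(5)] linear_graft_right)+
  moreover have "in1 (basis P) * in23 (basis ({#Node R#}, {#})) = in12 (basis (P, {#Node R#}))"
    by (simp flip: basis_add)
  ultimately show "split_right (graft_right (basis k))
      = in12 (graft_right (basis k)) + graft3 (split_right (basis k))"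
    by (simp add: k split_right_def coproduct_Node linear_add[OF linear_ins(4)] distrib_left
        del: ins_basis)
qed (intro linear_comp[OF linear_split(2)] linear_compose_add linear_comp[OF linear_ins(3)]
    linear_comp[OF linear_ins(5)] linear_graft_right linear_split)+

text \<open>
  With \<open>\<tau> = [M]\<close>, the recursion gives
  \<open>(\<Delta> \<otimes> Id) \<Delta> \<tau> = \<Delta> \<tau> \<otimes> \<emptyset> + (Id \<otimes> Id \<otimes> B\<^sub>+) (\<Delta> \<otimes> Id) \<Delta> M\<close> on one side and
  \<open>(Id \<otimes> \<Delta>) \<Delta> \<tau> = \<tau> \<otimes> \<emptyset> \<otimes> \<emptyset> + (Id \<otimes> B\<^sub>+) \<Delta> M \<otimes> \<emptyset> + (Id \<otimes> Id \<otimes> B\<^sub>+) (Id \<otimes> \<Delta>) \<Delta> M\<close> on the other; the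
  first two summands of the latter add up to \<open>\<Delta> \<tau> \<otimes> \<emptyset>\<close>.
\<close>

lemma coassociative: "split_left (coproduct x) = split_right (coproduct x)"
proof -
  have "(\<lambda>x. split_left (coproduct x)) = (\<lambda>x. split_right (coproduct x))"
  proof (rule alg_hom_ext_Node)
    fix M
    assume IH: "split_left (coproduct (basis M)) = split_right (coproduct (basis M))"
    let ?\<tau> = "{#Node M#}"
    have "split_left (coproduct (basis ?\<tau>))
        = in12 (coproduct (basis ?\<tau>)) * in3 1 + graft3 (split_left (coproduct (basis M)))"
      using basis_zero[where 'a = forest]
      by (subst coproduct_Node) (simp add: linear_add[OF linear_split(1)] split_left_graft,
          simp add: split_left_def del: ins_basis)
    also have "in3 1 = 1"
      by (rule alg_homD(2)[OF alg_hom_ins(2)])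
    also have "in12 (coproduct (basis ?\<tau>))
        = basis (?\<tau>, 0, 0) + in12 (graft_right (coproduct (basis M)))"
      by (simp add: coproduct_Node linear_add[OF linear_ins(3)])
    also have "basis (?\<tau>, 0, 0) = split_right (basis (?\<tau>, {#}))"
      using basis_zero[where 'a = forest]
      by (simp add: split_right_def alg_homD(2)[OF alg_hom_coproduct] alg_homD(2)[OF alg_hom_ins(4)])
    finally show "split_left (coproduct (basis ?\<tau>)) = split_right (coproduct (basis ?\<tau>))"
      by (simp add: IH coproduct_Node linear_add[OF linear_split(2)] split_right_graft)
  qed (rule alg_hom_comp[OF alg_hom_split(1) alg_hom_coproduct]
      alg_hom_comp[OF alg_hom_split(2) alg_hom_coproduct])+
  then show ?thesis
    by (rule fun_cong)
qed

definition conv :: "(hopf \<Rightarrow> 'b) \<Rightarrow> (hopf \<Rightarrow> 'b) \<Rightarrow> hopf \<Rightarrow> 'b::{real_algebra_1,comm_ring_1}"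
    (infixl "\<star>" 70) where
  "conv f g x = pairing f g (coproduct x)"

definition conv_unit :: "hopf \<Rightarrow> 'b::{real_algebra_1,comm_ring_1}" where
  "conv_unit x = counit x *\<^sub>R 1"

lemma alg_hom_conv: "alg_hom f \<Longrightarrow> alg_hom g \<Longrightarrow> alg_hom (f \<star> g)"
  unfolding conv_def[abs_def] by (intro alg_hom_comp[OF alg_hom_pairing alg_hom_coproduct])

lemma alg_hom_apply_conv: "alg_hom h \<Longrightarrow> (\<lambda>x. h ((f \<star> g) x)) = (\<lambda>x. h (f x)) \<star> (\<lambda>x. h (g x))"
  by (simp add: fun_eq_iff conv_def alg_hom_apply_pairing)

text \<open>
  Both sides apply \<open>f \<otimes> g \<otimes> h\<close>, followed by multiplication, to the two sides of coassociativity.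
  Linear maps in general occur in the uniqueness of the antipode.
\<close>

lemma conv_assoc:
  assumes f: "linear f" and g: "linear g" and h: "linear h"
  shows "(f \<star> g) \<star> h = f \<star> (g \<star> h)"
proof
  fix x
  let ?T = "lin_ext (\<lambda>(P, Q, R). f (basis P) * g (basis Q) * h (basis R))"
  have "pairing (f \<star> g) h y = ?T (split_left y)" for y
  proof (rule linear_eq_on_basis[where x = y])
    fix k :: "forest \<times> forest"
    obtain P R where k: "k = (P, R)"
      by (cases k)
    have "pairing f g z * h (basis R) = ?T (in12 z * in3 (basis R))" for z
    proof (rule linear_eq_on_basis[where x = z])
      fix l :: "forest \<times> forest"
      show "pairing f g (basis l) * h (basis R) = ?T (in12 (basis l) * in3 (basis R))"
        by (cases l) (simp flip: basis_add)
    qed (intro linear_mult_left linear_ins linear_comp[OF linear_lin_ext] linear_pairing)+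
    then show "pairing (f \<star> g) h (basis k) = ?T (split_left (basis k))"
      by (simp add: k split_left_def conv_def del: ins_basis)
  qed (intro linear_comp[OF linear_lin_ext] linear_pairing linear_split)+
  moreover have "pairing f (g \<star> h) y = ?T (split_right y)" for y
  proof (rule linear_eq_on_basis[where x = y])
    fix k :: "forest \<times> forest"
    obtain P R where k: "k = (P, R)"
      by (cases k)
    have "f (basis P) * pairing g h z = ?T (in1 (basis P) * in23 z)" for z
    proof (rule linear_eq_on_basis[where x = z])
      fix l :: "forest \<times> forest"
      show "f (basis P) * pairing g h (basis l) = ?T (in1 (basis P) * in23 (basis l))"
        by (cases l) (simp add: mult.assoc flip: basis_add)
    qed (intro linear_mult_right linear_ins linear_comp[OF linear_lin_ext] linear_pairing)+
    then show "pairing f (g \<star> h) (basis k) = ?T (split_right (basis k))"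
      by (simp add: k split_right_def conv_def del: ins_basis)
  qed (intro linear_comp[OF linear_lin_ext] linear_pairing linear_split)+
  ultimately show "((f \<star> g) \<star> h) x = (f \<star> (g \<star> h)) x"
    unfolding conv_def[of "f \<star> g"] conv_def[of f "g \<star> h"] by (simp add: coassociative)
qed

lemma conv_unit_basis: "conv_unit (basis F) = (if F = {#} then 1 else 0)"
  by (simp add: conv_unit_def counit_def)

lemma alg_hom_conv_unit: "alg_hom (conv_unit :: hopf \<Rightarrow> 'b::{real_algebra_1,comm_ring_1})"
proof -
  have eq: "conv_unit = lin_ext (\<lambda>F. if F = {#} then 1 else 0 :: 'b)"
    unfolding conv_unit_def[abs_def] counit_def
    by (rule ext)
       (subst linear_lin_ext_comp[of "\<lambda>r. r *\<^sub>R (1::'b)"],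
        auto intro!: lin_ext_cong linearI simp: scaleR_add_left)
  show ?thesis
    unfolding eq by (rule alg_hom_lin_ext) auto
qed

lemma conv_unit_right:
  fixes f :: "hopf \<Rightarrow> 'b::{real_algebra_1,comm_ring_1}"
  assumes f: "linear f"
  shows "f \<star> conv_unit = f"
proof -
  have *: "id \<star> conv_unit = (id :: hopf \<Rightarrow> hopf)"
  proof (rule alg_hom_ext_Node)
    fix M :: forest
    have "pairing id conv_unit (graft_right y) = (0 :: hopf)" for y
      by (rule linear_eq_on_basis[where x = y and g = "\<lambda>_. 0"])
         (auto intro!: linear_comp[OF linear_pairing] linear_zero
           simp: graft_right_basis_pair conv_unit_basis)
    then show "(id \<star> conv_unit) (basis {#Node M#}) = id (basis {#Node M#})"
      by (simp add: conv_def coproduct_Node linear_add[OF linear_pairing] conv_unit_basis)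
  qed (intro alg_hom_conv alg_hom_conv_unit alg_hom_id)+
  show ?thesis
  proof
    fix x
    have "pairing f conv_unit y = f (pairing id conv_unit y)" for y
      by (rule linear_eq_on_basis[where x = y])
         (auto intro!: linear_comp[OF f] linear_ident simp: conv_unit_basis linear_0[OF f])
    then show "(f \<star> conv_unit) x = f x"
      using fun_cong[OF *, of x] by (simp add: conv_def)
  qed
qed

lemma conv_unit_left:
  fixes f :: "hopf \<Rightarrow> 'b::{real_algebra_1,comm_ring_1}"
  assumes f: "linear f"
  shows "conv_unit \<star> f = f"
proof -
  have *: "conv_unit \<star> id = (id :: hopf \<Rightarrow> hopf)"
  proof (rule alg_hom_ext_Node)
    fix M :: forest
    let ?B = "lin_ext (\<lambda>R. basis {#Node R#}) :: hopf \<Rightarrow> hopf"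
    assume IH: "(conv_unit \<star> id) (basis M) = (id (basis M) :: hopf)"
    have "pairing conv_unit id (graft_right y) = ?B (pairing conv_unit id y)" for y
      by (rule linear_eq_on_basis[where x = y])
         (auto intro!: linear_comp[OF linear_pairing] linear_comp[OF linear_lin_ext] linear_ident
           simp: graft_right_basis_pair conv_unit_basis linear_0[OF linear_lin_ext])
    then show "(conv_unit \<star> id) (basis {#Node M#}) = id (basis {#Node M#})"
      using IH by (simp add: conv_def coproduct_Node linear_add[OF linear_pairing] conv_unit_basis)
  qed (intro alg_hom_conv alg_hom_conv_unit alg_hom_id)+
  show ?thesis
  proof
    fix x
    have "pairing conv_unit f y = f (pairing conv_unit id y)" for y
      by (rule linear_eq_on_basis[where x = y])
         (auto intro!: linear_comp[OF f] linear_ident simp: conv_unit_basis linear_0[OF f])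
    then show "(conv_unit \<star> f) x = f x"
      using fun_cong[OF *, of x] by (simp add: conv_def)
  qed
qed

section \<open>Grading, antipode and square roots\<close>

lemma pairing_cong:
  assumes "\<And>P R. (P, R) \<in> Poly_Mapping.keys x \<Longrightarrow> f (basis P) = f' (basis P)"
    and "\<And>P R. (P, R) \<in> Poly_Mapping.keys x \<Longrightarrow> g (basis R) = g' (basis R)"
  shows "pairing f g x = pairing f' g' x"
  unfolding pairing_def by (rule lin_ext_cong) (use assms in auto)

lemma nodes_pos [simp]: "nodes \<tau> > 0"
  by (cases \<tau>) simp

lemma forest_nodes_simps [simp]:
  "forest_nodes {#} = 0" "forest_nodes (add_mset \<tau> F) = nodes \<tau> + forest_nodes F"
  "forest_nodes (F + G) = forest_nodes F + forest_nodes G"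
  "nodes (Node M) = Suc (forest_nodes M)"
  by (simp_all add: forest_nodes_def)

declare nodes.simps [simp del]

lemma forest_nodes_eq_0 [simp]: "forest_nodes F = 0 \<longleftrightarrow> F = {#}"
  by (cases F) simp_all

lemma nodes_le_forest_nodes: "\<tau> \<in># F \<Longrightarrow> nodes \<tau> \<le> forest_nodes F"
  by (auto dest!: multi_member_split)

definition homogeneous :: "nat \<Rightarrow> hopf2 \<Rightarrow> bool" where
  "homogeneous n x \<longleftrightarrow> (\<forall>(P, R)\<in>Poly_Mapping.keys x. forest_nodes P + forest_nodes R = n)"

lemma homogeneous_mult:
  assumes "homogeneous m x" "homogeneous n y"
  shows "homogeneous (m + n) (x * y)"
proof -
  have "forest_nodes P + forest_nodes R = m + n" if k: "(P, R) \<in> Poly_Mapping.keys (x * y)" for P R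
  proof -
    obtain k l where kl: "(P, R) = k + l" "k \<in> Poly_Mapping.keys x" "l \<in> Poly_Mapping.keys y"
      using keys_mult[of x y] k by blast
    obtain P1 R1 P2 R2 where [simp]: "k = (P1, R1)" "l = (P2, R2)"
      by (cases k, cases l)
    have "P = P1 + P2" "R = R1 + R2"
      using kl(1) by simp_all
    moreover have "forest_nodes P1 + forest_nodes R1 = m" "forest_nodes P2 + forest_nodes R2 = n"
      using assms kl(2,3) by (auto simp: homogeneous_def)
    ultimately show ?thesis
      by simp
  qed
  then show ?thesis
    by (auto simp: homogeneous_def)
qed

lemma keys_graft_right:
  assumes "(P, R) \<in> Poly_Mapping.keys (graft_right x)"
  obtains R' where "R = {#Node R'#}" "(P, R') \<in> Poly_Mapping.keys x"
proof -
  have "graft_right x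
      = (\<Sum>k\<in>Poly_Mapping.keys x. Poly_Mapping.lookup x k *\<^sub>R graft_right (basis k))"
    using linear_lin_ext_comp[OF linear_graft_right, of basis x]
    unfolding lin_ext_basis_id unfolding lin_ext_def .
  then have "(\<Sum>k\<in>Poly_Mapping.keys x. Poly_Mapping.lookup x k *
      Poly_Mapping.lookup (graft_right (basis k)) (P, R)) \<noteq> 0"
    using assms by (simp only: in_keys_iff lookup_sum lookup_scaleR real_scaleR_def not_False_eq_True)
  then obtain k where "k \<in> Poly_Mapping.keys x"
    "Poly_Mapping.lookup x k * Poly_Mapping.lookup (graft_right (basis k)) (P, R) \<noteq> 0"
    by (rule sum.not_neutral_contains_not_neutral)
  then have "(P, R) \<in> Poly_Mapping.keys (graft_right (basis k))"
    unfolding in_keys_iff by (intro notI) simp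
  then have "P = fst k" "R = {#Node (snd k)#}"
    by (simp_all add: graft_right_basis_pair)
  then show ?thesis
    using that \<open>k \<in> Poly_Mapping.keys x\<close> by simp
qed

lemma homogeneous_coproduct: "homogeneous (forest_nodes F) (coproduct (basis F))"
proof -
  have forest: "homogeneous (forest_nodes F) (\<Prod>\<tau>\<in>#F. tree_coproduct \<tau>)"
    if "\<And>\<tau>. \<tau> \<in># F \<Longrightarrow> homogeneous (nodes \<tau>) (tree_coproduct \<tau>)" for F
    using that
  proof (induction F)
    case empty
    show ?case
      by (simp add: homogeneous_def zero_prod_def)
  next
    case (add \<tau> F)
    then show ?case
      by (simp add: homogeneous_mult)
  qed
  have "homogeneous (nodes \<tau>) (tree_coproduct \<tau>)" for \<tau>
  proof (induction \<tau>)
    case (Node M)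
    show ?case
      unfolding homogeneous_def
    proof clarify
      fix P R
      let ?y = "\<Prod>\<tau>\<in>#M. tree_coproduct \<tau>"
      assume "(P, R) \<in> Poly_Mapping.keys (tree_coproduct (Node M))"
      then consider "(P, R) = ({#Node M#}, {#})" | "(P, R) \<in> Poly_Mapping.keys (graft_right ?y)"
        using Poly_Mapping.keys_add[of "basis ({#Node M#}, {#})" "graft_right ?y"]
        unfolding tree_coproduct_Node by auto
      then show "forest_nodes P + forest_nodes R = nodes (Node M)"
      proof cases
        case 2
        then show ?thesis
          using forest[of M, OF Node.IH] by (auto elim!: keys_graft_right simp: homogeneous_def)
      qed simp
    qed
  qed
  then show ?thesis
    using forest by (simp add: coproduct_on_trees)
qed

definition reduced_coproduct :: "rtree \<Rightarrow> hopf2" where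
  "reduced_coproduct \<tau> = tree_coproduct \<tau> - basis ({#\<tau>#}, {#}) - basis ({#}, {#\<tau>#})"

text \<open>
  An admissible cut removes at least one edge, so both components are non-empty forests; as the
  coproduct preserves the number of vertices, both are smaller than the tree. This is what makes
  recursive definitions through the reduced coproduct well-founded.
\<close>

lemma keys_reduced_coproduct:
  assumes "(P, R) \<in> Poly_Mapping.keys (reduced_coproduct \<tau>)"
  shows "forest_nodes P < nodes \<tau>" "forest_nodes R < nodes \<tau>"
proof -
  let ?t = "planar \<tau>"
  have "reduced_coproduct \<tau>
      = (\<Sum>c\<in>admissible_cuts ?t. basis (cut_forest ?t c, {#root_component ?t c#}))"
    by (simp add: reduced_coproduct_def tree_coproduct_def)
  then have "Poly_Mapping.keys (reduced_coproduct \<tau>)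
      \<subseteq> (\<Union>c\<in>admissible_cuts ?t. {(cut_forest ?t c, {#root_component ?t c#})})"
    using keys_sum[of "\<lambda>c. basis (cut_forest ?t c, {#root_component ?t c#}) :: hopf2"
        "admissible_cuts ?t"] by simp
  then obtain c where c: "c \<in> admissible_cuts ?t" "P = cut_forest ?t c" "R = {#root_component ?t c#}"
    using assms by auto
  have "c \<noteq> {}" "finite c"
    using c(1) finite_antichain by (auto simp: admissible_cuts_antichains)
  then have "P \<noteq> {#}" "R \<noteq> {#}"
    using c by (auto simp: cut_forest_def mset_set_empty_iff)
  moreover have "forest_nodes P + forest_nodes R = nodes \<tau>"
  proof -
    have "(P, R) \<in> Poly_Mapping.keys (tree_coproduct \<tau>)"
      using assms \<open>P \<noteq> {#}\<close> \<open>R \<noteq> {#}\<close>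
      by (simp add: in_keys_iff reduced_coproduct_def lookup_minus basis_def lookup_single)
    then show ?thesis
      using homogeneous_coproduct[of "{#\<tau>#}"] by (auto simp: coproduct_tree homogeneous_def)
  qed
  ultimately show "forest_nodes P < nodes \<tau>" "forest_nodes R < nodes \<tau>"
    by (metis add.commute add_0 forest_nodes_eq_0 less_add_same_cancel1 neq0_conv)+
qed

lemma conv_tree:
  assumes "f 1 = 1" "g 1 = 1"
  shows "(f \<star> g) (basis {#\<tau>#})
    = f (basis {#\<tau>#}) + g (basis {#\<tau>#}) + pairing f g (reduced_coproduct \<tau>)"
proof -
  have "tree_coproduct \<tau> = basis ({#\<tau>#}, {#}) + basis ({#}, {#\<tau>#}) + reduced_coproduct \<tau>"
    by (simp add: reduced_coproduct_def)
  then show ?thesis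
    using assms basis_zero[where 'a = forest]
    by (simp add: conv_def coproduct_tree linear_add[OF linear_pairing])
qed

lemma tree_recursion:
  fixes \<Phi> :: "(rtree \<Rightarrow> 'b) \<Rightarrow> rtree \<Rightarrow> 'b"
  assumes "\<And>f g \<tau>. (\<And>\<sigma>. nodes \<sigma> < nodes \<tau> \<Longrightarrow> f \<sigma> = g \<sigma>) \<Longrightarrow> \<Phi> f \<tau> = \<Phi> g \<tau>"
  obtains f where "\<And>\<tau>. f \<tau> = \<Phi> f \<tau>"
proof -
  have "adm_wf (measure nodes) \<Phi>"
    unfolding adm_wf_def using assms by (metis in_measure)
  then have "wfrec (measure nodes) \<Phi> = \<Phi> (wfrec (measure nodes) \<Phi>)"
    by (intro wfrec_fixpoint) simp_all
  then show ?thesis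
    by (intro that) (rule fun_cong)
qed

lemma on_trees_cong:
  assumes "\<And>\<sigma>. nodes \<sigma> < n \<Longrightarrow> f \<sigma> = g \<sigma>" "forest_nodes P < n"
  shows "on_trees f (basis P) = on_trees g (basis P)"
proof -
  have "f \<sigma> = g \<sigma>" if "\<sigma> \<in># P" for \<sigma>
    using assms nodes_le_forest_nodes[OF that] by simp
  then show ?thesis
    by (simp cong: image_mset_cong)
qed

lemma on_trees_one: "on_trees f 1 = 1"
  by (rule alg_homD(2)[OF alg_hom_on_trees])

lemma alg_hom_apply_conv_id:
  assumes "alg_hom h"
  shows "h ((f \<star> id) x) = ((\<lambda>x. h (f x)) \<star> h) x"
  using alg_hom_apply_conv[OF assms, of f id] by (simp add: fun_eq_iff id_def)

lemma alg_hom_apply_unit: "alg_hom h \<Longrightarrow> h (conv_unit x) = conv_unit x"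
  by (simp add: conv_unit_def linear_scale alg_homD)

text \<open>
  The equation \<open>L \<star> Id = \<epsilon>\<close> determines an algebra morphism \<open>L\<close> recursively on trees. The same equation
  provides a left inverse \<open>L \<circ> L\<close> of \<open>L\<close> itself, because \<open>(L \<circ> L) \<star> L = L \<circ> (L \<star> Id) = \<epsilon>\<close>. In a monoid,
  an element \<open>L\<close> with left inverse \<open>L \<circ> L\<close> and right inverse \<open>Id\<close> is invertible and both inverses
  coincide, so \<open>L\<close> is also a right inverse of \<open>Id\<close>.
\<close>

lemma ex_conv_inverse:
  "\<exists>L :: hopf \<Rightarrow> hopf. alg_hom L \<and> L \<star> id = conv_unit \<and> id \<star> L = conv_unit"
proof -
  define \<Phi> :: "(rtree \<Rightarrow> hopf) \<Rightarrow> rtree \<Rightarrow> hopf" where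
    "\<Phi> = (\<lambda>f \<tau>. - basis {#\<tau>#} - pairing (on_trees f) id (reduced_coproduct \<tau>))"
  have cong: "\<Phi> f \<tau> = \<Phi> g \<tau>" if eq: "\<And>\<sigma>. nodes \<sigma> < nodes \<tau> \<Longrightarrow> f \<sigma> = g \<sigma>" for f g \<tau>
  proof -
    have "pairing (on_trees f) id (reduced_coproduct \<tau>)
        = pairing (on_trees g) id (reduced_coproduct \<tau>)"
      by (intro pairing_cong refl on_trees_cong[OF eq]) (blast dest: keys_reduced_coproduct)+
    then show ?thesis
      by (simp add: \<Phi>_def)
  qed
  obtain f where f: "\<And>\<tau>. f \<tau> = \<Phi> f \<tau>"
    using tree_recursion[of \<Phi>, OF cong] by blast
  define L where "L = on_trees f"
  have L: "alg_hom L"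
    by (simp add: L_def alg_hom_on_trees)
  have left: "L \<star> id = conv_unit"
  proof (rule alg_hom_ext_trees)
    fix \<tau>
    show "(L \<star> id) (basis {#\<tau>#}) = conv_unit (basis {#\<tau>#})"
      using f[of \<tau>] by (simp add: conv_tree on_trees_one conv_unit_basis L_def \<Phi>_def)
  qed (intro alg_hom_conv L alg_hom_id alg_hom_conv_unit)+
  define LL where "LL = (\<lambda>x. L (L x))"
  have LL: "linear LL"
    unfolding LL_def by (intro alg_homD(1) alg_hom_comp[OF L L])
  have LL_L: "LL \<star> L = conv_unit"
    using left by (simp add: fun_eq_iff LL_def alg_hom_apply_unit[OF L]
        flip: alg_hom_apply_conv_id[OF L])
  have "id = (LL \<star> L) \<star> id"
    by (simp add: LL_L conv_unit_left alg_homD(1)[OF alg_hom_id])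
  also have "\<dots> = LL \<star> (L \<star> id)"
    by (intro conv_assoc LL alg_homD(1) L alg_hom_id)
  also have "\<dots> = LL"
    by (simp add: left conv_unit_right[OF LL])
  finally have "id \<star> L = conv_unit"
    using LL_L by simp
  then show ?thesis
    using L left by blast
qed

lemma antipode_conv_inverse: "alg_hom antipode" "antipode \<star> id = conv_unit" "id \<star> antipode = conv_unit"
proof -
  obtain L :: "hopf \<Rightarrow> hopf" where L: "alg_hom L" "L \<star> id = conv_unit" "id \<star> L = conv_unit"
    using ex_conv_inverse by blast
  have "antipode = L"
    unfolding antipode_def
  proof (rule the_equality)
    show "linear L \<and> (\<forall>x. hopf_mult (tensor_map L id (coproduct x)) = counit x *\<^sub>R 1) \<and>
        (\<forall>x. hopf_mult (tensor_map id L (coproduct x)) = counit x *\<^sub>R 1)"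
      using L by (simp add: hopf_mult_tensor_map alg_homD(1) conv_unit_def fun_eq_iff flip: conv_def)
  next
    fix S :: "hopf \<Rightarrow> hopf"
    assume "linear S \<and> (\<forall>x. hopf_mult (tensor_map S id (coproduct x)) = counit x *\<^sub>R 1) \<and>
        (\<forall>x. hopf_mult (tensor_map id S (coproduct x)) = counit x *\<^sub>R 1)"
    then have S: "linear S" "S \<star> id = conv_unit"
      by (simp_all add: hopf_mult_tensor_map conv_unit_def fun_eq_iff flip: conv_def)
    have "S = S \<star> (id \<star> L)"
      by (simp add: L conv_unit_right S)
    also have "\<dots> = (S \<star> id) \<star> L"
      by (intro conv_assoc[symmetric] S alg_homD(1) L alg_hom_id)
    also have "\<dots> = L"
      by (simp add: S conv_unit_left L alg_homD(1))
    finally show "S = L" .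
  qed
  with L show "alg_hom antipode" "antipode \<star> id = conv_unit" "id \<star> antipode = conv_unit"
    by simp_all
qed

text \<open>
  On a tree, \<open>(h \<star> h) \<tau> = \<tau>\<close> reads \<open>2 h(\<tau>) + r = \<tau>\<close>, where \<open>r\<close> depends only on the values of \<open>h\<close> at smaller
  trees. So there is exactly one algebra morphism with this property.
\<close>

lemma half_id_square_root: "alg_hom half_id" "half_id \<star> half_id = id"
proof -
  let ?P = "\<lambda>f. unital_algebra_endomorphism f \<and> hopf_mult \<circ> tensor_map f f \<circ> coproduct = id"
  have P: "?P f \<longleftrightarrow> alg_hom f \<and> f \<star> f = id" for f
    by (simp add: unital_algebra_endomorphism_def alg_hom_def fun_eq_iff hopf_mult_tensor_map conv_def)
  define \<Phi> :: "(rtree \<Rightarrow> hopf) \<Rightarrow> rtree \<Rightarrow> hopf" where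
    "\<Phi> = (\<lambda>f \<tau>. (1/2) *\<^sub>R (basis {#\<tau>#} -
       pairing (on_trees f) (on_trees f) (reduced_coproduct \<tau>)))"
  have cong: "\<Phi> f \<tau> = \<Phi> g \<tau>" if eq: "\<And>\<sigma>. nodes \<sigma> < nodes \<tau> \<Longrightarrow> f \<sigma> = g \<sigma>" for f g \<tau>
  proof -
    have "pairing (on_trees f) (on_trees f) (reduced_coproduct \<tau>)
        = pairing (on_trees g) (on_trees g) (reduced_coproduct \<tau>)"
      by (intro pairing_cong refl on_trees_cong[OF eq]) (blast dest: keys_reduced_coproduct)+
    then show ?thesis
      by (simp add: \<Phi>_def)
  qed
  obtain f where f: "\<And>\<tau>. f \<tau> = \<Phi> f \<tau>"
    using tree_recursion[of \<Phi>, OF cong] by blast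
  define h where "h = on_trees f"
  have "h \<star> h = id"
  proof (rule alg_hom_ext_trees)
    fix \<tau>
    have "f \<tau> + f \<tau> = basis {#\<tau>#} - pairing h h (reduced_coproduct \<tau>)"
      unfolding f[of \<tau>] \<Phi>_def h_def by (simp flip: scaleR_add_left)
    then show "(h \<star> h) (basis {#\<tau>#}) = id (basis {#\<tau>#})"
      by (simp add: conv_tree on_trees_one h_def)
  qed (simp_all add: h_def alg_hom_conv alg_hom_on_trees alg_hom_id)
  then have h: "?P h"
    unfolding P by (simp add: h_def alg_hom_on_trees)
  have uniq: "f = g" if "?P f" "?P g" for f g
  proof -
    have f: "alg_hom f" "f \<star> f = id" and g: "alg_hom g" "g \<star> g = id"
      using that unfolding P by blast+
    have "f (basis {#\<tau>#}) = g (basis {#\<tau>#})" for \<tau>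
    proof (induction \<tau> rule: measure_induct_rule[of nodes])
      case (less \<tau>)
      have forest: "f (basis P) = g (basis P)" if "forest_nodes P < nodes \<tau>" for P
        unfolding alg_hom_forest[OF f(1), of P] alg_hom_forest[OF g(1), of P]
        by (intro arg_cong[where f = prod_mset] image_mset_cong less
            le_less_trans[OF nodes_le_forest_nodes that])
      have "pairing f f (reduced_coproduct \<tau>) = pairing g g (reduced_coproduct \<tau>)"
        by (rule pairing_cong) (auto intro: forest dest: keys_reduced_coproduct)
      moreover have "(f \<star> f) (basis {#\<tau>#}) = (g \<star> g) (basis {#\<tau>#})"
        by (simp add: f g)
      ultimately have "f (basis {#\<tau>#}) + f (basis {#\<tau>#}) = g (basis {#\<tau>#}) + g (basis {#\<tau>#})"
        by (simp add: conv_tree alg_homD(2)[OF f(1)] alg_homD(2)[OF g(1)])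
      then show ?case
        by (metis add_left_cancel add_diff_cancel scaleR_2 scaleR_left_imp_eq zero_neq_numeral)
    qed
    then show ?thesis
      by (rule alg_hom_ext_trees[OF f(1) g(1)])
  qed
  have "?P half_id"
    unfolding half_id_def by (rule theI[of ?P, OF h]) (rule uniq[OF _ h])
  then show "alg_hom half_id" "half_id \<star> half_id = id"
    unfolding P by blast+
qed

section \<open>Antisymmetric characters\<close>

text \<open>For the elementary weights of a scheme, this reverses the sign of the step size.\<close>

definition alternate :: "(hopf \<Rightarrow> 'b) \<Rightarrow> hopf \<Rightarrow> 'b::{real_algebra_1,comm_ring_1}" where
  "alternate f = lin_ext (\<lambda>F. (-1) ^ forest_nodes F *\<^sub>R f (basis F))"

lemma alternate_basis [simp]: "alternate f (basis F) = (-1) ^ forest_nodes F *\<^sub>R f (basis F)"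
  by (simp add: alternate_def)

lemma alg_hom_alternate:
  assumes f: "alg_hom f"
  shows "alg_hom (alternate f)"
  unfolding alternate_def
proof (rule alg_hom_lin_ext)
  show "(-1) ^ forest_nodes 0 *\<^sub>R f (basis 0) = 1"
    by (simp only: basis_zero alg_homD[OF f]) simp
  show "(-1) ^ forest_nodes (F + G) *\<^sub>R f (basis (F + G))
      = (-1) ^ forest_nodes F *\<^sub>R f (basis F) * (-1) ^ forest_nodes G *\<^sub>R f (basis G)" for F G
    by (simp add: basis_add alg_homD(3)[OF f] power_add)
qed

lemma alg_hom_apply_alternate:
  assumes "alg_hom h"
  shows "h (alternate f x) = alternate (\<lambda>y. h (f y)) x"
  unfolding alternate_def
  by (simp add: linear_lin_ext_comp alg_homD(1)[OF assms] linear_scale)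

text \<open>
  Since the coproduct is graded, agreement up to degree \<open>n\<close> is a congruence for convolution.
\<close>

definition agree :: "nat \<Rightarrow> (hopf \<Rightarrow> 'b) \<Rightarrow> (hopf \<Rightarrow> 'b) \<Rightarrow> bool" where
  "agree n f g \<longleftrightarrow> (\<forall>F. forest_nodes F \<le> n \<longrightarrow> f (basis F) = g (basis F))"

lemma agree_refl: "agree n f f"
  by (simp add: agree_def)

lemma agree_trans: "agree n f g \<Longrightarrow> agree n g h \<Longrightarrow> agree n f h"
  by (simp add: agree_def)

lemma agree_conv:
  assumes "agree n f f'" "agree n g g'"
  shows "agree n (f \<star> g) (f' \<star> g')"
  unfolding agree_def
proof (intro allI impI)
  fix F :: forest
  assume n: "forest_nodes F \<le> n"
  have "forest_nodes P \<le> n" "forest_nodes R \<le> n"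
    if "(P, R) \<in> Poly_Mapping.keys (coproduct (basis F))" for P R
    using homogeneous_coproduct[of F] n that by (auto simp: homogeneous_def)
  then show "(f \<star> g) (basis F) = (f' \<star> g') (basis F)"
    unfolding conv_def using assms unfolding agree_def by (intro pairing_cong) blast+
qed

lemma agree_trees:
  fixes f g :: "hopf \<Rightarrow> 'b::{real_algebra_1,comm_ring_1}"
  assumes f: "alg_hom f" and g: "alg_hom g"
    and eq: "\<And>\<tau>. nodes \<tau> \<le> n \<Longrightarrow> f (basis {#\<tau>#}) = g (basis {#\<tau>#})"
  shows "agree n f g"
  unfolding agree_def
proof (intro allI impI)
  fix F :: forest
  assume n: "forest_nodes F \<le> n"
  show "f (basis F) = g (basis F)"
    unfolding alg_hom_forest[OF f, of F] alg_hom_forest[OF g, of F]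
    by (intro arg_cong[where f = prod_mset] image_mset_cong eq
        order_trans[OF nodes_le_forest_nodes n])
qed

lemma agree_alternate: "agree n f g \<Longrightarrow> agree n (alternate f) (alternate g)"
  by (simp add: agree_def)

lemma alternate_alternate_agree: "agree n (alternate (alternate f)) f"
  by (simp add: agree_def flip: power_add)

lemma character_antipode:
  fixes f :: "hopf \<Rightarrow> 'b::{real_algebra_1,comm_ring_1}"
  assumes f: "alg_hom f"
  shows "(\<lambda>x. f (antipode x)) \<star> f = conv_unit" "f \<star> (\<lambda>x. f (antipode x)) = conv_unit"
  using alg_hom_apply_conv[OF f, of antipode id] alg_hom_apply_conv[OF f, of id antipode]
  by (simp_all add: antipode_conv_inverse alg_hom_apply_unit[OF f])

text \<open>
  Below, \<open>m\<close> and \<open>p\<close> are \<open>\<psi>\<close> composed with the minus and the plus map. From \<open>m \<star> m = alternate i \<star> \<psi>\<close>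
  and \<open>p \<star> m = \<psi>\<close> the claim follows by computing modulo degrees above \<open>n\<close>, where \<open>p\<close> is the unit.
\<close>

lemma antisymmetric_character:
  fixes \<psi> :: "hopf \<Rightarrow> 'b::{real_algebra_1,comm_ring_1}"
  assumes \<psi>: "alg_hom \<psi>"
    and plus: "\<And>\<tau>. nodes \<tau> \<le> n \<Longrightarrow> \<psi> (plus_map (basis {#\<tau>#})) = 0"
  shows "agree n (alternate \<psi> \<star> \<psi>) conv_unit"
proof -
  define i where "i = (\<lambda>x. \<psi> (antipode x))"
  define \<theta> where "\<theta> = alternate i \<star> \<psi>"
  define m where "m = (\<lambda>x. \<theta> (half_id x))"
  define p where "p = \<psi> \<star> (\<lambda>x. m (antipode x))"
  have i: "alg_hom i"
    unfolding i_def by (rule alg_hom_comp[OF \<psi> antipode_conv_inverse(1)])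
  have \<theta>: "alg_hom \<theta>"
    unfolding \<theta>_def by (intro alg_hom_conv alg_hom_alternate i \<psi>)
  have m: "alg_hom m"
    unfolding m_def by (rule alg_hom_comp[OF \<theta> half_id_square_root(1)])
  have mS: "alg_hom (\<lambda>x. m (antipode x))"
    by (rule alg_hom_comp[OF m antipode_conv_inverse(1)])
  have p: "alg_hom p"
    unfolding p_def by (intro alg_hom_conv \<psi> mS)
  have minus: "\<psi> (minus_map x) = m x" for x
  proof -
    have "minus_map x = (alternate antipode \<star> id) (half_id x)"
      by (simp add: minus_map_def hopf_mult_tensor_map conv_def alternate_def signed_antipode_def)
    then show ?thesis
      unfolding m_def \<theta>_def i_def
      by (simp add: alg_hom_apply_conv_id[OF \<psi>] alg_hom_apply_alternate[OF \<psi>])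
  qed
  have plus_p: "\<psi> (plus_map x) = p x" for x
  proof -
    have "plus_map x = (id \<star> (\<lambda>x. minus_map (antipode x))) x"
      by (simp add: plus_map_def hopf_mult_tensor_map conv_def o_def)
    then show ?thesis
      using fun_cong[OF alg_hom_apply_conv[OF \<psi>, of id "\<lambda>x. minus_map (antipode x)"], of x]
      by (simp add: p_def minus)
  qed
  have "m \<star> m = \<theta>"
    using alg_hom_apply_conv[OF \<theta>, of half_id half_id] by (simp add: half_id_square_root(2) flip: m_def)
  have "p \<star> m = \<psi> \<star> ((\<lambda>x. m (antipode x)) \<star> m)"
    unfolding p_def by (intro conv_assoc alg_homD(1) \<psi> m mS)
  also have "\<dots> = \<psi>"
    by (simp add: character_antipode(1)[OF m] conv_unit_right alg_homD(1) \<psi>)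
  finally have "p \<star> m = \<psi>" .
  moreover have "conv_unit \<star> m = m"
    by (simp add: conv_unit_left alg_homD(1) m)
  moreover have "agree n p conv_unit"
    by (rule agree_trees[OF p alg_hom_conv_unit]) (simp add: plus conv_unit_basis flip: plus_p)
  ultimately have "agree n \<psi> m"
    using agree_conv[OF _ agree_refl, of n p conv_unit m] by simp
  then have "agree n (\<psi> \<star> \<psi>) (alternate i \<star> \<psi>)"
    using agree_conv[of n \<psi> m \<psi> m] by (simp add: \<open>m \<star> m = \<theta>\<close> \<theta>_def)
  then have "agree n ((\<psi> \<star> \<psi>) \<star> i) ((alternate i \<star> \<psi>) \<star> i)"
    by (rule agree_conv[OF _ agree_refl])
  moreover have cancel: "(f \<star> \<psi>) \<star> i = f" if f: "linear f" for f
  proof -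
    have "(f \<star> \<psi>) \<star> i = f \<star> (\<psi> \<star> i)"
      by (intro conv_assoc f alg_homD(1) \<psi> i)
    then show ?thesis
      using character_antipode(2)[OF \<psi>] conv_unit_right[OF f] by (simp add: i_def)
  qed
  ultimately have "agree n \<psi> (alternate i)"
    by (simp add: cancel alg_homD(1) \<psi> alg_hom_alternate i)
  then have "agree n (alternate \<psi>) i"
    by (rule agree_trans[OF agree_alternate alternate_alternate_agree])
  then have "agree n (alternate \<psi> \<star> \<psi>) (i \<star> \<psi>)"
    by (rule agree_conv[OF _ agree_refl])
  then show ?thesis
    using character_antipode(1)[OF \<psi>] by (simp add: i_def)
qed

section \<open>The adjoint scheme\<close>

text \<open>
  Applied to the elementary weights of a scheme and of its stages, this expresses the convolution
  on a tree by convolutions on the forest of its branches. It is the composition of two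
  Runge--Kutta schemes, with the first one adding its weight to every stage of the second.
\<close>

lemma conv_Node:
  fixes f g :: "hopf \<Rightarrow> real"
  assumes "g 1 = 1" "\<And>R. g (basis {#Node R#}) = (\<Sum>j\<in>J. a j * h j (basis R))"
  shows "(f \<star> g) (basis {#Node M#})
    = f (basis {#Node M#}) + (\<Sum>j\<in>J. a j * (f \<star> h j) (basis M))"
proof -
  have "pairing f g (graft_right y) = (\<Sum>j\<in>J. a j * pairing f (h j) y)" for y
  proof (rule linear_eq_on_basis[where x = y])
    fix k :: "forest \<times> forest"
    show "pairing f g (graft_right (basis k)) = (\<Sum>j\<in>J. a j * pairing f (h j) (basis k))"
      by (cases k) (simp add: assms(2) sum_distrib_left mult.left_commute)
  qed (rule linear_comp[OF linear_pairing linear_graft_right],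
      intro linear_compose_sum ballI linear_mult_right linear_pairing)
  then show ?thesis
    using assms(1) basis_zero[where 'a = forest]
    by (simp add: conv_def coproduct_Node linear_add[OF linear_pairing])
qed

lemma elementary_weights_on_trees: "elementary_weights s A b = on_trees (tree_weight s A b)"
  by (simp add: elementary_weights_def on_trees_def)

lemma stage_weight_Node:
  "stage_weight s A (Node M) i = (\<Sum>j=1..s. A i j * (\<Prod>\<sigma>\<in>#M. stage_weight s A \<sigma> j))"
  by (simp add: image_mset.compositionality o_def)

lemma tree_weight_Node:
  "tree_weight s A b (Node M) = (\<Sum>j=1..s. b j * (\<Prod>\<sigma>\<in>#M. stage_weight s A \<sigma> j))"
  by (simp add: tree_weight_def)

declare stage_weight.simps [simp del]

text \<open>
  Put \<open>Y\<^sub>i = alternate \<psi> \<star> X\<^sub>i\<close>, where \<open>X\<^sub>i\<close> is the character of the weights of stage \<open>i\<close>. On \<open>\<tau> = [M]\<close>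
  the assumption says that \<open>alternate \<psi>\<close> has the value \<open>- \<Sum>\<^sub>j b\<^sub>j Y\<^sub>j(M)\<close>. Inserting this in the
  recursion for the \<open>Y\<^sub>i\<close> yields \<open>Y\<^sub>i(\<tau>) = \<Sum>\<^sub>j (a\<^sub>i\<^sub>j - b\<^sub>j) Y\<^sub>j(M)\<close>, which up to the sign \<open>(-1)\<^sup>|\<^sup>\<tau>\<^sup>|\<close> is the
  recursion for the stage weights of the adjoint scheme.
\<close>

lemma adjoint_scheme:
  fixes s :: nat and A :: "nat \<Rightarrow> nat \<Rightarrow> real" and b :: "nat \<Rightarrow> real"
  defines "\<psi> \<equiv> elementary_weights s A b"
    and "A' \<equiv> \<lambda>i j. b j - A i j"
  assumes sym: "agree n (alternate \<psi> \<star> \<psi>) conv_unit"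
    and n: "nodes \<tau> \<le> n"
  shows "tree_weight s A b \<tau> = tree_weight s A' b \<tau>"
proof -
  define X where "X = (\<lambda>i. on_trees (\<lambda>\<tau>. stage_weight s A \<tau> i))"
  have \<psi>: "alg_hom \<psi>"
    by (simp add: \<psi>_def elementary_weights_on_trees alg_hom_on_trees)
  have X: "alg_hom (X i)" for i
    by (simp add: X_def alg_hom_on_trees)
  have X_Node: "X i (basis {#Node R#}) = (\<Sum>j=1..s. A i j * X j (basis R))" for i R
    by (simp add: X_def stage_weight_Node)
  have \<psi>_Node: "\<psi> (basis {#Node R#}) = (\<Sum>j=1..s. b j * X j (basis R))" for R
    by (simp add: X_def \<psi>_def elementary_weights_on_trees tree_weight_Node)
  let ?\<phi> = "alternate \<psi>"
  have root: "?\<phi> (basis {#Node M#}) = - (\<Sum>j=1..s. b j * (?\<phi> \<star> X j) (basis M))"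
    if "nodes (Node M) \<le> n" for M
    using sym that conv_Node[of \<psi> b X "{1..s}" ?\<phi> M, OF alg_homD(2)[OF \<psi>] \<psi>_Node]
    by (simp add: agree_def conv_unit_basis)
  have forest: "(?\<phi> \<star> X j) (basis M) = (-1) ^ forest_nodes M * (\<Prod>\<sigma>\<in>#M. stage_weight s A' \<sigma> j)"
    if "\<And>\<sigma>. \<sigma> \<in># M \<Longrightarrow>
      (?\<phi> \<star> X j) (basis {#\<sigma>#}) = (-1) ^ nodes \<sigma> * stage_weight s A' \<sigma> j" for M j
  proof -
    have "(?\<phi> \<star> X j) (basis M) = (\<Prod>\<sigma>\<in>#M. (-1) ^ nodes \<sigma> * stage_weight s A' \<sigma> j)"
      using that
      by (subst alg_hom_forest[OF alg_hom_conv[OF alg_hom_alternate[OF \<psi>] X]])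
         (intro arg_cong[where f = prod_mset] image_mset_cong)
    also have "\<dots> = (-1) ^ forest_nodes M * (\<Prod>\<sigma>\<in>#M. stage_weight s A' \<sigma> j)"
      by (induction M) (simp_all add: power_add)
    finally show ?thesis .
  qed
  have stage: "(?\<phi> \<star> X i) (basis {#\<sigma>#}) = (-1) ^ nodes \<sigma> * stage_weight s A' \<sigma> i"
    if "nodes \<sigma> \<le> n" for \<sigma> i
    using that
  proof (induction \<sigma> arbitrary: i)
    case (Node M)
    have le: "nodes \<sigma> \<le> n" if "\<sigma> \<in># M" for \<sigma>
      using nodes_le_forest_nodes[OF that] Node.prems by simp
    have M: "(?\<phi> \<star> X j) (basis M) = (-1) ^ forest_nodes M * (\<Prod>\<sigma>\<in>#M. stage_weight s A' \<sigma> j)" for j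
      by (rule forest) (rule Node.IH[OF _ le])
    have "(?\<phi> \<star> X i) (basis {#Node M#})
        = ?\<phi> (basis {#Node M#}) + (\<Sum>j=1..s. A i j * (?\<phi> \<star> X j) (basis M))"
      by (rule conv_Node[OF alg_homD(2)[OF X] X_Node])
    also have "\<dots> = (\<Sum>j=1..s. (A i j - b j) * (?\<phi> \<star> X j) (basis M))"
      by (simp only: root[OF Node.prems] left_diff_distrib sum_subtractf)
    also have "\<dots> = (-1) ^ nodes (Node M) * stage_weight s A' (Node M) i"
      by (simp add: M stage_weight_Node A'_def sum_distrib_left algebra_simps flip: sum_negf)
    finally show ?case .
  qed
  obtain M where \<tau>: "\<tau> = Node M"
    by (cases \<tau>)
  have le: "nodes \<sigma> \<le> n" if "\<sigma> \<in># M" for \<sigma>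
    using nodes_le_forest_nodes[OF that] n \<tau> by simp
  have "(?\<phi> \<star> X j) (basis M) = (-1) ^ forest_nodes M * (\<Prod>\<sigma>\<in>#M. stage_weight s A' \<sigma> j)" for j
    by (rule forest) (rule stage[OF le])
  then have "?\<phi> (basis {#\<tau>#}) = (-1) ^ nodes \<tau> * tree_weight s A' b \<tau>"
    using root[of M] n
    by (simp add: \<tau> tree_weight_Node sum_distrib_left algebra_simps flip: sum_negf)
  moreover have "?\<phi> (basis {#\<tau>#}) = (-1) ^ nodes \<tau> * tree_weight s A b \<tau>"
    by (simp add: \<psi>_def elementary_weights_on_trees)
  ultimately show ?thesis
    by simp
qed

section \<open>Three explicit stages\<close>

text \<open>
  The supremum is finite, hence attained, and the conditions for a larger order contain those for
  a smaller one.
\<close>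

lemma antisymmetric_orderD:
  assumes "antisymmetric_order \<psi> = enat m" "nodes \<tau> \<le> m"
  shows "\<psi> (plus_map (basis {#\<tau>#})) = 0"
proof (rule ccontr)
  assume neq: "\<psi> (plus_map (basis {#\<tau>#})) \<noteq> 0"
  have "antisymmetric_order \<psi> \<le> enat (nodes \<tau> - 1)"
    unfolding antisymmetric_order_def
  proof (rule Sup_least, clarify)
    fix k
    assume "\<forall>\<tau>. nodes \<tau> \<le> k \<longrightarrow> \<psi> (plus_map (basis {#\<tau>#})) = 0"
    then have "\<not> nodes \<tau> \<le> k"
      using neq by blast
    then show "enat k \<le> enat (nodes \<tau> - 1)"
      by simp
  qed
  then have "m \<le> nodes \<tau> - 1"
    using assms(1) by simp
  then show False
    using assms(2) nodes_pos[of \<tau>] by linarith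
qed

lemma sum_to_3: "(\<Sum>i=1..3. f i) = f 1 + f 2 + f (3::nat)" for f :: "nat \<Rightarrow> real"
  by (simp add: numeral_3_eq_3 numeral_2_eq_2)

text \<open>
  The two equations for \<open>b\<^sub>2 c\<^sub>2\<^sup>2 + b\<^sub>3 c\<^sub>3\<^sup>2\<close> give \<open>c\<^sub>3 = c\<^sub>2 + 1/2\<close>; then \<open>b\<^sub>3 (2 c\<^sub>2 + 1) = 1 - c\<^sub>2\<close> and
  \<open>b\<^sub>2 c\<^sub>2 = c\<^sub>2/2\<close>. The equation \<open>b\<^sub>3 a\<^sub>3\<^sub>2 c\<^sub>2 = 1/8\<close> forbids \<open>c\<^sub>2 = 0\<close>, so \<open>b\<^sub>2 = 1/2\<close>, and it excludes
  the parameters \<open>b\<^sub>1 = 1/2\<close> (that is \<open>b\<^sub>3 = 0\<close>) and \<open>b\<^sub>1 = -1/2\<close> (that is \<open>c\<^sub>2 = 0\<close>).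
\<close>

lemma three_stage_equations:
  fixes b1 b2 b3 c2 c3 a31 a32 :: real
  assumes cons: "b1 + b2 + b3 = 1"
    and T1: "b2 * c2 + b3 * c3 = 1/2"
    and q: "b3 * a32 * c2 = 1/8"
    and p1: "b2 * c2^2 + b3 * c3^2 = c3/4 + 1/8"
    and p2: "b2 * c2^2 + b3 * c3^2 = c2/4 + 1/4"
    and c3: "c3 = a31 + a32"
  shows "b1 \<noteq> 1 \<and> b1 \<noteq> 1/2 \<and> b1 \<noteq> -1/2 \<and> b2 = 1/2 \<and> b3 = 1/2 - b1 \<and>
    c2 = (1 + 2*b1) / (4 * (1 - b1)) \<and> c3 = 3 / (4 * (1 - b1)) \<and>
    a32 = (1 - b1) / (1 - 4 * b1^2) \<and> a31 = (4*b1 - 1)^2 / (4 * (b1 - 1) * (1 - 4 * b1^2))"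
proof -
  have c3': "c3 = c2 + 1/2"
    using p1 p2 by simp
  have nz: "b3 \<noteq> 0" "c2 \<noteq> 0" "a32 \<noteq> 0"
    using q by auto
  have b3c: "b3 * (2 * c2 + 1) = 1 - c2"
    using p2 T1 unfolding c3' power2_eq_square by algebra
  have "b2 * c2 = 1/2 * c2"
    using T1 b3c unfolding c3' by algebra
  then have b2: "b2 = 1/2"
    using nz by simp
  have b3: "b3 = 1/2 - b1"
    using cons b2 by simp
  have c2: "c2 * (4 * (1 - b1)) = 1 + 2 * b1"
    using b3c unfolding b3 by algebra
  have ne1: "b1 \<noteq> 1"
    using c2 by auto
  have ne2: "b1 \<noteq> 1/2"
    using b3 nz by auto
  have ne3: "b1 \<noteq> -1/2"
    using c2 nz ne1 by auto
  have ne4: "1 - 4 * b1^2 \<noteq> 0"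
  proof -
    have "1 - 4 * b1^2 = (1 - 2 * b1) * (1 + 2 * b1)"
      by (simp add: power2_eq_square algebra_simps)
    then show ?thesis
      using ne2 ne3 by simp
  qed
  have c2_eq: "c2 = (1 + 2*b1) / (4 * (1 - b1))"
    using c2 ne1 by (simp add: eq_divide_eq)
  have c3_eq: "c3 = 3 / (4 * (1 - b1))"
    using c2 ne1 unfolding c3' by (simp add: eq_divide_eq algebra_simps)
  have "a32 * (1 - 4 * b1^2) = 1 - b1"
    using q c2 unfolding b3 by algebra
  then have a32: "a32 = (1 - b1) / (1 - 4 * b1^2)"
    using ne4 by (simp add: eq_divide_eq)
  have "a31 = 3 / (4 * (1 - b1)) - (1 - b1) / (1 - 4 * b1^2)"
    using c3 c3_eq a32 by simp
  also have "\<dots> = (3 * (1 - 4 * b1^2) - (1 - b1) * (4 * (1 - b1))) / ((4 * (1 - b1)) * (1 - 4 * b1^2))"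
    using ne1 ne4 by (subst diff_frac_eq) simp_all
  also have "3 * (1 - 4 * b1^2) - (1 - b1) * (4 * (1 - b1)) = - ((4*b1 - 1)^2)"
    by (simp add: power2_eq_square algebra_simps)
  also have "(4 * (1 - b1)) * (1 - 4 * b1^2) = - (4 * (b1 - 1) * (1 - 4 * b1^2))"
    by (simp add: algebra_simps)
  finally have "a31 = (4*b1 - 1)^2 / (4 * (b1 - 1) * (1 - 4 * b1^2))"
    by simp
  then show ?thesis
    using ne1 ne2 ne3 b2 b3 c2_eq c3_eq a32 by blast
qed

theorem proposition8p4:
  fixes A :: "nat \<Rightarrow> nat \<Rightarrow> real" and b :: "nat \<Rightarrow> real"
  assumes "(3, A, b) \<in> EES 2 5"
  shows "\<exists>x::real. x \<noteq> 1 \<and> x \<noteq> 1/2 \<and> x \<noteq> - 1/2 \<and>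
    A 2 1 = (1 + 2*x) / (4 * (1 - x)) \<and>
    A 3 1 = (4*x - 1)^2 / (4 * (x - 1) * (1 - 4 * x^2)) \<and>
    A 3 2 = (1 - x) / (1 - 4 * x^2) \<and>
    b 1 = x \<and> b 2 = 1/2 \<and> b 3 = 1/2 - x \<and>
    rk_node 3 A 1 = 0 \<and>
    rk_node 3 A 2 = (1 + 2*x) / (4 * (1 - x)) \<and>
    rk_node 3 A 3 = 3 / (4 * (1 - x)) \<and>
    (\<forall>i\<in>{1..3}. \<forall>j\<in>{1..3}. (i, j) \<notin> {(2, 1), (3, 1), (3, 2)} \<longrightarrow> A i j = 0)"
proof -
  \<comment> \<open>otherwise stage 1 would be rewritten to a form that the equations for the stages do not match\<close>
  note One_nat_def [simp del]
  define \<psi> where "\<psi> = elementary_weights 3 A b"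
  have cons: "b 1 + b 2 + b 3 = 1"
  proof -
    have "consistent 3 b"
      using assms by (simp add: EES_def)
    then show ?thesis
      unfolding consistent_def sum_to_3 .
  qed
  have expl: "A i j = 0" if "i \<in> {1..3}" "j \<in> {1..3}" "i \<le> j" for i j
    using assms that by (simp add: EES_def explicit_def)
  have zero: "A 1 1 = 0" "A 1 2 = 0" "A 1 3 = 0" "A 2 2 = 0" "A 2 3 = 0" "A 3 3 = 0"
    by (simp_all add: expl)
  have plus: "\<psi> (plus_map (basis {#\<tau>#})) = 0" if "nodes \<tau> \<le> 5" for \<tau>
    using assms that by (intro antisymmetric_orderD[of _ 5]) (simp_all add: EES_def \<psi>_def)
  have "alg_hom \<psi>"
    by (simp add: \<psi>_def elementary_weights_on_trees alg_hom_on_trees)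
  then have "agree 5 (alternate \<psi> \<star> \<psi>) conv_unit"
    using plus by (rule antisymmetric_character)
  then have adj: "tree_weight 3 A b \<tau> = tree_weight 3 (\<lambda>i j. b j - A i j) b \<tau>"
    if "nodes \<tau> \<le> 5" for \<tau>
    using that unfolding \<psi>_def by (rule adjoint_scheme)
  let ?c3 = "A 3 1 + A 3 2" and ?p = "b 2 * (A 2 1)^2 + b 3 * (A 3 1 + A 3 2)^2"
  define t1 where "t1 = Node {#}"
  define t2 where "t2 = Node {#t1#}"
  have nodes: "nodes t1 = 1" "nodes t2 = 2"
    by (simp_all add: t1_def t2_def)
  note weights = tree_weight_Node stage_weight_Node sum_to_3 zero
  have b1: "b 1 = 1 - b 2 - b 3"
    using cons by simp
  have T1: "b 2 * A 2 1 + b 3 * ?c3 = 1/2"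
    using adj[of "Node {#t1#}"]
    by (simp add: nodes) (simp add: t1_def weights b1 algebra_simps)
  have s1: "stage_weight 3 A t1 1 = 0" "stage_weight 3 A t1 2 = A 2 1" "stage_weight 3 A t1 3 = ?c3"
    by (simp_all add: t1_def weights)
  have s2: "stage_weight 3 A t2 1 = 0" "stage_weight 3 A t2 2 = 0"
      "stage_weight 3 A t2 3 = A 3 2 * A 2 1"
    by (simp_all add: t2_def weights s1)
  let ?A = "\<lambda>i j. b j - A i j"
  have z1: "stage_weight 3 ?A t1 1 = 1" "stage_weight 3 ?A t1 2 = 1 - A 2 1"
      "stage_weight 3 ?A t1 3 = 1 - ?c3"
    by (simp_all add: t1_def weights b1)
  have z2: "stage_weight 3 ?A t2 1 = 1/2" "stage_weight 3 ?A t2 2 = 1/2 - A 2 1"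
      "stage_weight 3 ?A t2 3 = 1/2 - ?c3 + A 3 2 * A 2 1"
    using T1 unfolding t2_def by (simp_all add: weights z1 b1 algebra_simps)
  \<comment> \<open>the path with four vertices, to which three explicit stages assign the weight 0\<close>
  have q: "b 3 * A 3 2 * A 2 1 = 1/8"
  proof -
    have s3: "stage_weight 3 A (Node {#t2#}) 1 = 0" "stage_weight 3 A (Node {#t2#}) 2 = 0"
      "stage_weight 3 A (Node {#t2#}) 3 = 0"
      by (simp_all add: weights s2)
    have z3: "stage_weight 3 ?A (Node {#t2#}) i
        = (b 1 - A i 1) * (1/2) + (b 2 - A i 2) * (1/2 - A 2 1)
          + (b 3 - A i 3) * (1/2 - ?c3 + A 3 2 * A 2 1)" for i
      by (simp add: stage_weight_Node sum_to_3 z2)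
    have "(b 1 + b 2 + b 3) * (b 1 * (1/2) + b 2 * (1/2 - A 2 1) + b 3 * (1/2 - ?c3 + A 3 2 * A 2 1))
        = b 2 * (A 2 1 * (1/2)) + b 3 * (A 3 1 * (1/2) + A 3 2 * (1/2 - A 2 1))"
      using adj[of "Node {#Node {#t2#}#}"]
      by (simp add: nodes tree_weight_Node sum_to_3 s3 z3 zero algebra_simps)
    then have "2 * (b 3 * A 3 2 * A 2 1)
        = 3/2 * (b 2 * A 2 1 + b 3 * ?c3) - 1/2 * (b 1 + b 2 + b 3)"
      unfolding cons by (simp add: b1 algebra_simps)
    then show ?thesis
      unfolding T1 cons by simp
  qed
  \<comment> \<open>each of the next two identities is rearranged so that, apart from \<open>p\<close>, only the known values of
    \<open>b\<^sub>1 + b\<^sub>2 + b\<^sub>3\<close>, \<open>b\<^sub>2 c\<^sub>2 + b\<^sub>3 c\<^sub>3\<close> and \<open>b\<^sub>3 a\<^sub>3\<^sub>2 c\<^sub>2\<close> and one of the nodes remain\<close>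
  have p1: "?p = ?c3/4 + 1/8"
  proof -
    have "b 3 * (?c3 * (A 3 2 * A 2 1)) = b 1 * (1/2) + b 2 * ((1 - A 2 1) * (1/2 - A 2 1))
        + b 3 * ((1 - ?c3) * (1/2 - ?c3 + A 3 2 * A 2 1))"
      using adj[of "Node {#t1, t2#}"] by (simp add: nodes tree_weight_Node sum_to_3 s1 s2 z1 z2)
    then have "?p = 2 * ?c3 * (b 3 * A 3 2 * A 2 1) - 1/2 * (b 1 + b 2 + b 3)
        + 3/2 * (b 2 * A 2 1 + b 3 * ?c3) - b 3 * A 3 2 * A 2 1"
      by algebra
    then show ?thesis
      unfolding q T1 cons by simp
  qed
  have p2: "?p = A 2 1/4 + 1/4"
  proof -
    have s3: "stage_weight 3 A (Node {#t1, t1#}) 1 = 0"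
      "stage_weight 3 A (Node {#t1, t1#}) 2 = 0"
      "stage_weight 3 A (Node {#t1, t1#}) 3 = A 3 2 * (A 2 1 * A 2 1)"
      by (simp_all add: weights s1)
    have z3: "stage_weight 3 ?A (Node {#t1, t1#}) i
        = (b 1 - A i 1) + (b 2 - A i 2) * ((1 - A 2 1) * (1 - A 2 1))
          + (b 3 - A i 3) * ((1 - ?c3) * (1 - ?c3))" for i
      by (simp add: stage_weight_Node sum_to_3 z1)
    have "b 3 * (A 3 2 * (A 2 1 * A 2 1)) =
        (b 1 + b 2 + b 3) * (b 1 + b 2 * ((1 - A 2 1) * (1 - A 2 1)) + b 3 * ((1 - ?c3) * (1 - ?c3)))
        - b 2 * A 2 1 - b 3 * (A 3 1 + A 3 2 * ((1 - A 2 1) * (1 - A 2 1)))"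
      using adj[of "Node {#Node {#t1, t1#}#}"]
      by (simp add: nodes tree_weight_Node sum_to_3 s3 z3 zero algebra_simps)
    then have "?p = 2 * A 2 1 * (b 3 * A 3 2 * A 2 1) - (b 1 + b 2 + b 3)
        + 3 * (b 2 * A 2 1 + b 3 * ?c3) - 2 * (b 3 * A 3 2 * A 2 1)"
      unfolding cons by (simp add: b1 algebra_simps power2_eq_square)
    then show ?thesis
      unfolding q T1 cons by simp
  qed
  have nodes3: "rk_node 3 A 1 = 0" "rk_node 3 A 2 = A 2 1" "rk_node 3 A 3 = ?c3"
    by (simp_all add: rk_node_def sum_to_3 zero)
  have rest: "A i j = 0" if "i \<in> {1..3}" "j \<in> {1..3}" "(i, j) \<notin> {(2, 1), (3, 1), (3, 2)}" for i j
    using that by (intro expl) (auto simp: le_Suc_eq numeral_3_eq_3 numeral_2_eq_2)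
  show ?thesis
    using three_stage_equations[OF cons T1 q p1 p2 refl] rest unfolding nodes3
    by (intro exI[of _ "b 1"]) simp
qed

end
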